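(* Let $\mathcal N$ be a nonzero $4$-dimensional nilpotent "pure" Novikov algebra over $\mathbb C$. Then $\mathcal N$ is isomorphic to one of the following algebras, each given by its multiplication table in a basis $e_1,e_2,e_3,e_4$ (all products of basis elements not listed are zero): $\mathcal N^4_{01}$: $e_1e_1=e_2$, $e_2e_1=e_3$; $\mathcal N^4_{02}(\lambda)$, $\lambda\in\mathbb C$: $e_1e_1=e_2$, $e_1e_2=e_3$, $e_2e_1=\lambda e_3$; $\mathcal N^4_{03}$: $e_1e_1=e_2$, $e_1e_2=e_4$, $e_2e_1=e_3$; $\mathcal N^4_{04}(\alpha)$, $\alpha\in\mathbb C$: $e_1e_1=e_2$, $e_1e_2=e_4$, $e_2e_1=\alpha e_4$, $e_3e_3=e_4$; $\mathcal N^4_{05}$: $e_1e_1=e_2$, $e_1e_2=e_4$, $e_1e_3=e_4$, $e_2e_1=e_4$, $e_3e_3=e_4$; $\mathcal N^4_{06}(\alpha)$, $\alpha\in\mathbb C\setminus\{0\}$: $e_1e_1=e_2$, $e_1e_2=e_4$, $e_1e_3=e_4$, $e_2e_1=\alpha e_4$; $\mathcal N^4_{07}$: $e_1e_1=e_2$, $e_2e_1=e_4$, $e_3e_3=e_4$; $\mathcal N^4_{08}$: $e_1e_1=e_2$, $e_1e_3=e_4$, $e_2e_1=e_4$; $\mathcal N^4_{09}$: $e_1e_1=e_2$, $e_1e_2=e_4$, $e_3e_1=e_4$; $\mathcal N^4_{10}$: $e_1e_2=e_3$, $e_1e_3=e_4$; $\mathcal N^4_{11}$: $e_1e_2=e_3$,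 $e_1e_3=e_4$, $e_2e_1=e_4$; $\mathcal N^4_{12}$: $e_1e_2=e_3$, $e_2e_3=e_4$, $e_3e_2=-e_4$; $\mathcal N^4_{13}$: $e_1e_2=e_3$, $e_1e_1=e_4$, $e_2e_3=e_4$, $e_3e_2=-e_4$; $\mathcal N^4_{14}$: $e_1e_2=e_3$, $e_1e_3=e_4$, $e_2e_3=e_4$, $e_3e_2=-e_4$; $\mathcal N^4_{15}$: $e_1e_2=e_3$, $e_1e_1=e_4$, $e_1e_3=e_4$, $e_2e_3=e_4$, $e_3e_2=-e_4$; $\mathcal N^4_{16}$: $e_1e_2=e_3$, $e_1e_3=e_4$, $e_2e_2=e_4$; $\mathcal N^4_{17}$: $e_1e_2=e_3$, $e_1e_3=e_4$, $e_2e_1=e_4$, $e_2e_2=e_4$; $\mathcal N^4_{18}$: $e_1e_2=e_3$, $e_2e_2=e_4$, $e_2e_3=e_4$, $e_3e_2=-e_4$; $\mathcal N^4_{19}$: $e_1e_2=e_3$, $e_1e_1=e_4$, $e_2e_2=e_4$, $e_2e_3=e_4$, $e_3e_2=-e_4$; $\mathcal N^4_{20}(\alpha)$, $\alpha\in\mathbb C$: $e_1e_2=e_3$, $e_1e_1=\alpha e_4$, $e_1e_3=e_4$, $e_2e_2=e_4$, $e_2e_3=e_4$, $e_3e_2=-e_4$; $\mathcal N^4_{21}$: $e_1e_1=e_2$, $e_2e_1=e_3$, $e_1e_3=e_4$, $e_3e_1=-e_4$; $\mathcal N^4_{22}(\lambda)$, $\lambda\in\mathbb C$: $e_1e_1=e_2$,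 $e_1e_2=e_3$, $e_1e_3=(2-\lambda)e_4$, $e_2e_1=\lambda e_3$, $e_2e_2=\lambda e_4$, $e_3e_1=\lambda e_4$; $\mathcal N^4_{23}$: $e_1e_1=e_2$, $e_1e_2=e_3$, $e_1e_3=2e_4$, $e_2e_1=e_4$; $\mathcal N^4_{24}$: $e_1e_1=e_2$, $e_1e_2=e_3$, $e_1e_3=e_4$, $e_2e_1=e_3+e_4$, $e_2e_2=e_4$, $e_3e_1=e_4$.
   Context: An algebra over $\mathbb C$ is a $\mathbb C$-vector space with a bilinear product (not assumed associative, commutative or unital). A Novikov algebra is an algebra satisfying, for all $x,y,z$, the identities $$(xy)z=(xz)y,\qquad (xy)z-x(yz)=(yx)z-y(xz).$$ An algebra $\mathbf A$ is nilpotent if there is $k\ge 1$ such that every product of $k$ elements of $\mathbf A$, with any arrangement of brackets, is zero. A nilpotent Novikov algebra is called "pure" if it does not satisfy the identity $xyz=0$, i.e. if it does not satisfy both identities $(xy)z=0$ and $x(yz)=0$ (at least one of the two fails). *)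

theory Defs
  imports "HOL-Analysis.Analysis"
begin

locale complex_algebra = vector_space scale
  for scale :: "complex \<Rightarrow> 'a::ab_group_add \<Rightarrow> 'a" +
  fixes mul :: "'a \<Rightarrow> 'a \<Rightarrow> 'a" (infixl "\<star>" 70)
  assumes linear_mult_left: "Vector_Spaces.linear scale scale (\<lambda>x. x \<star> y)"
    and linear_mult_right: "Vector_Spaces.linear scale scale (\<lambda>y. x \<star> y)"

locale novikov_algebra = complex_algebra +
  assumes right_commutative: "(x \<star> y) \<star> z = (x \<star> z) \<star> y"
    and left_symmetric:
      "(x \<star> y) \<star> z - x \<star> (y \<star> z) = (y \<star> x) \<star> z - y \<star> (x \<star> z)"

(* bracketed_product mul k x: x is a product of k elements, for some choice of the
   elements and some arrangement of brackets. *)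
inductive bracketed_product :: "('a \<Rightarrow> 'a \<Rightarrow> 'a) \<Rightarrow> nat \<Rightarrow> 'a \<Rightarrow> bool"
  for mul :: "'a \<Rightarrow> 'a \<Rightarrow> 'a"
  where
    single: "bracketed_product mul 1 x"
  | times: "bracketed_product mul m x \<Longrightarrow> bracketed_product mul n y
      \<Longrightarrow> bracketed_product mul (m + n) (mul x y)"

definition nilpotent_algebra :: "('a::zero \<Rightarrow> 'a \<Rightarrow> 'a) \<Rightarrow> bool" where
  "nilpotent_algebra mul \<longleftrightarrow> (\<exists>k\<ge>1. \<forall>x. bracketed_product mul k x \<longrightarrow> x = 0)"

definition pure_algebra :: "('a::zero \<Rightarrow> 'a \<Rightarrow> 'a) \<Rightarrow> bool" where
  "pure_algebra mul \<longleftrightarrow>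
     \<not> ((\<forall>x y z. mul (mul x y) z = 0) \<and> (\<forall>x y z. mul x (mul y z) = 0))"

definition isomorphic_algebras ::
  "(complex \<Rightarrow> 'a::ab_group_add \<Rightarrow> 'a) \<Rightarrow> ('a \<Rightarrow> 'a \<Rightarrow> 'a) \<Rightarrow>
   (complex \<Rightarrow> 'b::ab_group_add \<Rightarrow> 'b) \<Rightarrow> ('b \<Rightarrow> 'b \<Rightarrow> 'b) \<Rightarrow> bool" where
  "isomorphic_algebras scale1 mul1 scale2 mul2 \<longleftrightarrow>
     (\<exists>f. Vector_Spaces.linear scale1 scale2 f \<and> bij f \<and>
          (\<forall>x y. f (mul1 x y) = mul2 (f x) (f y)))"

(* The standard basis of complex^4.  The index type 4 is arithmetic modulo 4, so the
   index 4 denotes the same element as 0; the indices 1, 2, 3, 4 are distinct. *)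
abbreviation e :: "4 \<Rightarrow> complex^4" where
  "e i \<equiv> axis i 1"

(* The bilinear product on complex^4 given by a multiplication table: an entry (i, j, v)
   stands for e i * e j = v, and products of basis vectors not listed are zero. *)
definition table_mult ::
  "(4 \<times> 4 \<times> (complex^4)) list \<Rightarrow> complex^4 \<Rightarrow> complex^4 \<Rightarrow> complex^4" where
  "table_mult ps x y = (\<Sum>(i, j, v)\<leftarrow>ps. (x $ i * y $ j) *s v)"

lemma table_mult_basis_unlisted:
  assumes "(i, j) \<notin> (\<lambda>(i, j, v). (i, j)) ` set ps"
  shows "table_mult ps (e i) (e j) = 0"
  using assms unfolding table_mult_def
  by (induction ps) (auto simp: axis_def)

lemma table_mult_basis_listed:
  assumes "distinct (map (\<lambda>(i, j, v). (i, j)) ps)" and "(i, j, v) \<in> set ps"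
  shows "table_mult ps (e i) (e j) = v"
  using assms
proof (induction ps)
  case Nil
  then show ?case by simp
next
  case (Cons p ps)
  obtain k l w where p: "p = (k, l, w)" by (cases p)
  show ?case
  proof (cases "k = i \<and> l = j")
    case True
    then have unlisted: "(i, j) \<notin> (\<lambda>(i, j, v). (i, j)) ` set ps"
      using Cons.prems(1) p by simp
    then have "w = v" using Cons.prems(2) p by force
    then show ?thesis
      using True p table_mult_basis_unlisted[OF unlisted] by (simp add: table_mult_def)
  next
    case False
    then show ?thesis
      using Cons p by (auto simp: table_mult_def axis_def)
  qed
qed

definition N01 :: "complex^4 \<Rightarrow> complex^4 \<Rightarrow> complex^4" where
  "N01 = table_mult
     [(1, 1, e 2), (2, 1, e 3)]"

definition N02 :: "complex \<Rightarrow> complex^4 \<Rightarrow> complex^4 \<Rightarrow> complex^4" where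
  "N02 \<alpha> = table_mult
     [(1, 1, e 2), (1, 2, e 3), (2, 1, \<alpha> *s e 3)]"

definition N03 :: "complex^4 \<Rightarrow> complex^4 \<Rightarrow> complex^4" where
  "N03 = table_mult
     [(1, 1, e 2), (1, 2, e 4), (2, 1, e 3)]"

definition N04 :: "complex \<Rightarrow> complex^4 \<Rightarrow> complex^4 \<Rightarrow> complex^4" where
  "N04 \<alpha> = table_mult
     [(1, 1, e 2), (1, 2, e 4), (2, 1, \<alpha> *s e 4), (3, 3, e 4)]"

definition N05 :: "complex^4 \<Rightarrow> complex^4 \<Rightarrow> complex^4" where
  "N05 = table_mult
     [(1, 1, e 2), (1, 2, e 4), (1, 3, e 4), (2, 1, e 4),
      (3, 3, e 4)]"

definition N06 :: "complex \<Rightarrow> complex^4 \<Rightarrow> complex^4 \<Rightarrow> complex^4" where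
  "N06 \<alpha> = table_mult
     [(1, 1, e 2), (1, 2, e 4), (1, 3, e 4), (2, 1, \<alpha> *s e 4)]"

definition N07 :: "complex^4 \<Rightarrow> complex^4 \<Rightarrow> complex^4" where
  "N07 = table_mult
     [(1, 1, e 2), (2, 1, e 4), (3, 3, e 4)]"

definition N08 :: "complex^4 \<Rightarrow> complex^4 \<Rightarrow> complex^4" where
  "N08 = table_mult
     [(1, 1, e 2), (1, 3, e 4), (2, 1, e 4)]"

definition N09 :: "complex^4 \<Rightarrow> complex^4 \<Rightarrow> complex^4" where
  "N09 = table_mult
     [(1, 1, e 2), (1, 2, e 4), (3, 1, e 4)]"

definition N10 :: "complex^4 \<Rightarrow> complex^4 \<Rightarrow> complex^4" where
  "N10 = table_mult
     [(1, 2, e 3), (1, 3, e 4)]"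

definition N11 :: "complex^4 \<Rightarrow> complex^4 \<Rightarrow> complex^4" where
  "N11 = table_mult
     [(1, 2, e 3), (1, 3, e 4), (2, 1, e 4)]"

definition N12 :: "complex^4 \<Rightarrow> complex^4 \<Rightarrow> complex^4" where
  "N12 = table_mult
     [(1, 2, e 3), (2, 3, e 4), (3, 2, - e 4)]"

definition N13 :: "complex^4 \<Rightarrow> complex^4 \<Rightarrow> complex^4" where
  "N13 = table_mult
     [(1, 2, e 3), (1, 1, e 4), (2, 3, e 4), (3, 2, - e 4)]"

definition N14 :: "complex^4 \<Rightarrow> complex^4 \<Rightarrow> complex^4" where
  "N14 = table_mult
     [(1, 2, e 3), (1, 3, e 4), (2, 3, e 4), (3, 2, - e 4)]"

definition N15 :: "complex^4 \<Rightarrow> complex^4 \<Rightarrow> complex^4" where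
  "N15 = table_mult
     [(1, 2, e 3), (1, 1, e 4), (1, 3, e 4), (2, 3, e 4),
      (3, 2, - e 4)]"

definition N16 :: "complex^4 \<Rightarrow> complex^4 \<Rightarrow> complex^4" where
  "N16 = table_mult
     [(1, 2, e 3), (1, 3, e 4), (2, 2, e 4)]"

definition N17 :: "complex^4 \<Rightarrow> complex^4 \<Rightarrow> complex^4" where
  "N17 = table_mult
     [(1, 2, e 3), (1, 3, e 4), (2, 1, e 4), (2, 2, e 4)]"

definition N18 :: "complex^4 \<Rightarrow> complex^4 \<Rightarrow> complex^4" where
  "N18 = table_mult
     [(1, 2, e 3), (2, 2, e 4), (2, 3, e 4), (3, 2, - e 4)]"

definition N19 :: "complex^4 \<Rightarrow> complex^4 \<Rightarrow> complex^4" where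
  "N19 = table_mult
     [(1, 2, e 3), (1, 1, e 4), (2, 2, e 4), (2, 3, e 4),
      (3, 2, - e 4)]"

definition N20 :: "complex \<Rightarrow> complex^4 \<Rightarrow> complex^4 \<Rightarrow> complex^4" where
  "N20 \<alpha> = table_mult
     [(1, 2, e 3), (1, 1, \<alpha> *s e 4), (1, 3, e 4), (2, 2, e 4),
      (2, 3, e 4), (3, 2, - e 4)]"

definition N21 :: "complex^4 \<Rightarrow> complex^4 \<Rightarrow> complex^4" where
  "N21 = table_mult
     [(1, 1, e 2), (2, 1, e 3), (1, 3, e 4), (3, 1, - e 4)]"

definition N22 :: "complex \<Rightarrow> complex^4 \<Rightarrow> complex^4 \<Rightarrow> complex^4" where
  "N22 \<alpha> = table_mult
     [(1, 1, e 2), (1, 2, e 3), (1, 3, (2 - \<alpha>) *s e 4), (2, 1, \<alpha> *s e 3),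
      (2, 2, \<alpha> *s e 4), (3, 1, \<alpha> *s e 4)]"

definition N23 :: "complex^4 \<Rightarrow> complex^4 \<Rightarrow> complex^4" where
  "N23 = table_mult
     [(1, 1, e 2), (1, 2, e 3), (1, 3, 2 *s e 4), (2, 1, e 4)]"

definition N24 :: "complex^4 \<Rightarrow> complex^4 \<Rightarrow> complex^4" where
  "N24 = table_mult
     [(1, 1, e 2), (1, 2, e 3), (1, 3, e 4), (2, 1, e 3 + e 4),
      (2, 2, e 4), (3, 1, e 4)]"

end

theory Submission
  imports Defs
begin

text \<open>
  Write \<open>A\<^sup>1 = A\<close> and let \<open>A\<^sup>k\<^sup>+\<^sup>1\<close> be the span of \<open>A A\<^sup>k\<close> and \<open>A\<^sup>k A\<close>. In a nilpotent algebra these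
  ideals decrease strictly until they vanish, and a pure algebra has \<open>A\<^sup>3 \<noteq> 0\<close>. In dimension 4
  this leaves \<open>dim A\<^sup>2 = 2\<close> and \<open>dim A\<^sup>2 = 3\<close>. What makes the algebras tractable is that right
  commutativity, \<open>(uv)w = (uw)v\<close>, forces \<open>A\<^sup>2 A\<^sup>k \<subseteq> A\<^sup>k\<^sup>+\<^sup>2\<close> (lemma \<open>lcs1_lcs_mul\<close>), so that few
  products of basis vectors survive.

  If \<open>dim A\<^sup>2 = 2\<close>, then \<open>A\<^sup>3\<close> is a line spanned by some \<open>d\<close>, \<open>A\<^sup>4 = 0\<close>, and \<open>A\<^sup>2\<close> is spanned by \<open>c\<close> and
  \<open>d\<close>. All products of three elements are encoded in a bilinear form \<open>B\<close> and two linear functionals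
  \<open>l\<close>, \<open>r\<close>: one has \<open>xy = B(x,y) c\<close> modulo \<open>d\<close>, \<open>xc = l(x) d\<close>, \<open>cx = r(x) d\<close>. The two Novikov identities
  become equations between \<open>B\<close>, \<open>l\<close>, \<open>r\<close> whose solutions are \<open>B(x,y) = f(x) g(y)\<close>, \<open>r = m g\<close>,
  \<open>l = t f - m g\<close> with functionals \<open>f\<close>, \<open>g\<close> and scalars \<open>t\<close>, \<open>m\<close>, not both zero (lemma
  \<open>two_generators\<close>). If \<open>g\<close> is a multiple of \<open>f\<close>, then \<open>A\<^sup>2\<close> is spanned modulo \<open>A\<^sup>3\<close> by a square
  \<open>e\<^sub>1 e\<^sub>1\<close>; otherwise a basis dual to \<open>f\<close>, \<open>g\<close> makes \<open>e\<^sub>1 e\<^sub>2\<close> span it. In both situations the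
  table has five parameters. Adding to the generators a multiple of a suitable vector removes some of
  them, and rescaling the basis normalises what is left; since \<open>\<complex>\<close> has square roots, only the listed
  tables remain (\<open>square_type_classification\<close>, \<open>mixed_type_classification\<close>).

  If \<open>dim A\<^sup>2 = 3\<close>, then \<open>A\<close> is generated by one element \<open>e\<^sub>1\<close>. With \<open>e\<^sub>2 = e\<^sub>1 e\<^sub>1\<close>, the ideal \<open>A\<^sup>3\<close> is
  spanned modulo \<open>A\<^sup>4\<close> by \<open>e\<^sub>1 e\<^sub>2\<close> and \<open>e\<^sub>2 e\<^sub>1\<close>. If \<open>A\<^sup>4 = 0\<close>, these two products complete \<open>e\<^sub>1\<close>,
  \<open>e\<^sub>2\<close> to a basis. Otherwise \<open>A\<^sup>4\<close> is a line and \<open>A\<^sup>5 = 0\<close>; then \<open>e\<^sub>1 e\<^sub>2\<close> and \<open>e\<^sub>2 e\<^sub>1\<close> are dependent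
  modulo \<open>A\<^sup>4\<close>, and the identities express the products of four factors by the coefficients of this
  dependence and one scalar (lemma \<open>one_generated_case\<close>).
\<close>

section \<open>Isomorphisms from multiplication tables\<close>

text \<open>The entry in row \<open>i\<close> and column \<open>j\<close> of the matrix is the product of the \<open>i\<close>-th and the \<open>j\<close>-th
  vector. Writing tables with concrete lists lets the simplifier turn them into the list of all
  products.\<close>

definition (in complex_algebra) has_table :: "'a list \<Rightarrow> 'a list list \<Rightarrow> bool" where
  "has_table bs P \<longleftrightarrow> span (set bs) = UNIV \<and> map (\<lambda>x. map ((\<star>) x) bs) bs = P"

lemma table_mult_expand:
  "table_mult ps x y = (\<Sum>i\<in>UNIV. \<Sum>j\<in>UNIV. (x $ i * y $ j) *s table_mult ps (e i) (e j))"
proof (induction ps)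
  case Nil
  then show ?case by (simp add: table_mult_def)
next
  case (Cons p ps)
  obtain k l v where p: "p = (k, l, v)" by (cases p)
  have step: "table_mult (p # ps) u w = (u $ k * w $ l) *s v + table_mult ps u w" for u w
    by (simp add: table_mult_def p)
  have "(\<Sum>i\<in>UNIV. \<Sum>j\<in>UNIV. (x $ i * y $ j) *s ((e i $ k * e j $ l) *s v))
      = (\<Sum>i\<in>UNIV. \<Sum>j\<in>UNIV. if i = k then (if j = l then (x $ i * y $ j) *s v else 0) else 0)"
    by (intro sum.cong refl) (simp add: axis_def)
  also have "\<dots> = (x $ k * y $ l) *s v"
    by (simp add: sum.delta if_distrib[of "sum _"] sum.swap)
  finally show ?case
    unfolding step Cons.IH by (simp add: vec.scale_right_distrib sum.distrib)
qed

context complex_algebra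
begin

lemma mul_add_left: "(x + y) \<star> z = x \<star> z + y \<star> z"
  using linear_mult_left[of z] by (simp add: Vector_Spaces.linear_iff)

lemma mul_add_right: "z \<star> (x + y) = z \<star> x + z \<star> y"
  using linear_mult_right[of z] by (simp add: Vector_Spaces.linear_iff)

lemma mul_scale_left: "scale k x \<star> y = scale k (x \<star> y)"
  using linear_mult_left[of y] by (simp add: Vector_Spaces.linear_iff)

lemma mul_scale_right: "x \<star> scale k y = scale k (x \<star> y)"
  using linear_mult_right[of x] by (simp add: Vector_Spaces.linear_iff)

lemma mul_zero_left [simp]: "0 \<star> x = 0"
  using mul_add_left[of 0 0 x] by simp

lemma mul_zero_right [simp]: "x \<star> 0 = 0"
  using mul_add_right[of x 0 0] by simp

lemma mul_minus_left: "(- x) \<star> y = - (x \<star> y)"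
  using mul_add_left[of "- x" x y] by (simp add: eq_neg_iff_add_eq_0)

lemma mul_minus_right: "y \<star> (- x) = - (y \<star> x)"
  using mul_add_right[of y "- x" x] by (simp add: eq_neg_iff_add_eq_0)

lemma mul_diff_left: "(x - y) \<star> z = x \<star> z - y \<star> z"
  using mul_add_left[of x "- y" z] by (simp add: mul_minus_left)

lemma mul_diff_right: "z \<star> (x - y) = z \<star> x - z \<star> y"
  using mul_add_right[of z x "- y"] by (simp add: mul_minus_right)

lemmas mul_linear = mul_add_left mul_add_right mul_diff_left mul_diff_right
  mul_minus_left mul_minus_right mul_scale_left mul_scale_right

lemma mul_sum_left: "(\<Sum>i\<in>I. h i) \<star> y = (\<Sum>i\<in>I. h i \<star> y)"
  by (induction I rule: infinite_finite_induct) (simp_all add: mul_add_left)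

lemma mul_sum_right: "y \<star> (\<Sum>i\<in>I. h i) = (\<Sum>i\<in>I. y \<star> h i)"
  by (induction I rule: infinite_finite_induct) (simp_all add: mul_add_right)

end

locale algebra4 =
  complex_algebra scale mul + finite_dimensional_vector_space scale Basis
  for scale :: "complex \<Rightarrow> 'a::ab_group_add \<Rightarrow> 'a" (infixr "\<cdot>" 75)
    and mul :: "'a \<Rightarrow> 'a \<Rightarrow> 'a" (infixl "\<star>" 70)
    and Basis :: "'a set" +
  assumes dim4: "dim UNIV = 4"
begin

text \<open>By bilinearity the linear extension of \<open>e i \<mapsto> b i\<close> is multiplicative; it is onto because the
  \<open>b i\<close> span, hence bijective because both spaces have dimension 4. Its inverse is the isomorphism.\<close>

lemma isomorphic_if_basis_products:
  assumes span: "span (range b) = UNIV"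
    and products: "\<And>i j. b i \<star> b j = (\<Sum>k\<in>UNIV. table_mult ps (e i) (e j) $ k \<cdot> b k)"
  shows "isomorphic_algebras (\<cdot>) (\<star>) (*s) (table_mult ps)"
proof -
  interpret pair: finite_dimensional_vector_space_pair "(*s)" "cart_basis :: (complex^4) set" scale Basis ..
  define g where "g v = (\<Sum>k\<in>UNIV. v $ k \<cdot> b k)" for v :: "complex^4"
  have lin: "Vector_Spaces.linear (*s) (\<cdot>) g"
    by (auto simp: Vector_Spaces.linear_iff g_def scale_left_distrib sum.distrib scale_sum_right
        intro!: vec.vector_space_axioms vector_space_axioms)
  then interpret g: Vector_Spaces.linear "(*s)" "(\<cdot>)" g .
  have "g (e i) = b i" for i
    by (simp add: g_def axis_def if_distrib[of "\<lambda>c. c \<cdot> _"] cong: if_cong)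
  then have "range b \<subseteq> range g" by (metis image_subsetI rangeI)
  then have "span (range b) \<subseteq> range g"
    by (intro span_minimal g.subspace_image vec.subspace_UNIV)
  then have "surj g" using span by auto
  then obtain f where f: "Vector_Spaces.linear (\<cdot>) (*s) f" "\<And>x. f (g x) = x" "\<And>x. g (f x) = x"
    using pair.linear_surjective_isomorphism[OF lin] dim4 vec_dim_card[where 'n=4 and 'a=complex]
    by auto
  have hom: "g (table_mult ps x y) = g x \<star> g y" for x y
  proof -
    have "g (table_mult ps x y) = (\<Sum>i\<in>UNIV. \<Sum>j\<in>UNIV. (x $ i * y $ j) \<cdot> g (table_mult ps (e i) (e j)))"
      by (subst table_mult_expand) (simp add: g.sum g.scale)
    also have "\<dots> = (\<Sum>i\<in>UNIV. \<Sum>j\<in>UNIV. (x $ i * y $ j) \<cdot> (b i \<star> b j))"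
      by (simp add: g_def products)
    also have "\<dots> = g x \<star> g y"
      unfolding g_def mul_sum_left by (simp add: mul_sum_right mul_scale_left mul_scale_right mult.commute)
    finally show ?thesis .
  qed
  have "f (x \<star> y) = table_mult ps (f x) (f y)" for x y
    by (metis f(2,3) hom)
  moreover have "bij f" by (metis f(2,3) bijI')
  ultimately show ?thesis using f(1) unfolding isomorphic_algebras_def by blast
qed

text \<open>The form in which the criterion is applied: for a concrete list \<open>ps\<close> the simplifier evaluates the
  matrix.\<close>

lemma isomorphic_if_table:
  assumes "has_table [b1, b2, b3, b4]
     (map (\<lambda>i. map (\<lambda>j. let v = table_mult ps (e i) (e j)
        in v $ 1 \<cdot> b1 + v $ 2 \<cdot> b2 + v $ 3 \<cdot> b3 + v $ 4 \<cdot> b4) [1, 2, 3, 4]) [1, 2, 3, 4])"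
  shows "isomorphic_algebras (\<cdot>) (\<star>) (*s) (table_mult ps)"
proof (rule isomorphic_if_basis_products)
  let ?b = "\<lambda>i::4. if i = 1 then b1 else if i = 2 then b2 else if i = 3 then b3 else b4"
  have "range ?b = {b1, b2, b3, b4}" unfolding UNIV_4 by (simp add: insert_commute)
  then show "span (range ?b) = UNIV" using assms by (simp add: has_table_def)
  have "\<forall>i j. ?b i \<star> ?b j = (\<Sum>k\<in>UNIV. table_mult ps (e i) (e j) $ k \<cdot> ?b k)"
    using assms by (simp add: has_table_def forall_4 sum_4 Let_def)
  then show "?b i \<star> ?b j = (\<Sum>k\<in>UNIV. table_mult ps (e i) (e j) $ k \<cdot> ?b k)" for i j by blast
qed

abbreviation isomorphic_to :: "(complex^4 \<Rightarrow> complex^4 \<Rightarrow> complex^4) \<Rightarrow> bool" where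
  "isomorphic_to M \<equiv> isomorphic_algebras (\<cdot>) (\<star>) (*s) M"

section \<open>Changes of basis and adapted bases\<close>

lemma span_replace:
  assumes "span (insert x S) = UNIV" and "k \<noteq> 0" and "y \<in> span S"
  shows "span (insert (k \<cdot> x + y) S) = UNIV"
proof -
  let ?T = "insert (k \<cdot> x + y) S"
  have "y \<in> span ?T" using assms(3) span_mono[of S ?T] by blast
  moreover have "k \<cdot> x + y \<in> span ?T" by (simp add: span_base)
  ultimately have "inverse k \<cdot> ((k \<cdot> x + y) - y) \<in> span ?T"
    by (intro span_scale span_diff)
  then have "x \<in> span ?T" using \<open>k \<noteq> 0\<close> by simp
  then have "insert x S \<subseteq> span ?T" by (simp add: span_base subset_iff)
  then show ?thesis using assms(1) span_minimal[OF _ subspace_span] by blast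
qed

lemma span_shift:
  assumes "span (insert x S) = UNIV" and "y \<in> span S"
  shows "span (insert (x + y) S) = UNIV"
  using span_replace[OF assms(1) _ assms(2), of 1] by simp

text \<open>Every normalisation below is a composition of unitriangular changes of basis, whose spanning
  property comes from replacing one vector at a time, and of a diagonal one.\<close>

lemma span_rescale:
  assumes "span {e1, e2, e3, e4} = UNIV"
    and "a1 \<noteq> 0" "a2 \<noteq> 0" "a3 \<noteq> 0" "a4 \<noteq> 0"
  shows "span {a1 \<cdot> e1, a2 \<cdot> e2, a3 \<cdot> e3, a4 \<cdot> e4} = UNIV"
proof -
  note scale1 = span_replace[where y = 0, OF _ _ span_zero, simplified]
  have "span {e2, e3, e4, a1 \<cdot> e1} = UNIV" using scale1[OF assms(1,2)] by (simp add: insert_commute)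
  from scale1[OF this assms(3)] have "span {e3, e4, a1 \<cdot> e1, a2 \<cdot> e2} = UNIV" by (simp add: insert_commute)
  from scale1[OF this assms(4)] have "span {e4, a1 \<cdot> e1, a2 \<cdot> e2, a3 \<cdot> e3} = UNIV" by (simp add: insert_commute)
  from scale1[OF this assms(5)] show ?thesis by (simp add: insert_commute)
qed

lemma span_insert_eq_of_dim:
  assumes "subspace U" "subspace W" "U \<subseteq> W" "x \<in> W" "x \<notin> U" "dim W = Suc (dim U)"
  shows "span (insert x U) = W"
proof (rule subspace_dim_equal)
  show "span (insert x U) \<subseteq> W" using assms by (intro span_minimal) auto
  have "span U = U"  using assms(1) by (simp only: span_eq_iff)
  then have "x \<notin> span U" using assms(5) by metis
  then show "dim W \<le> dim (span (insert x U))" using assms(6) by (simp add: dim_insert)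
qed (use assms in auto)

lemma obtain_span_insert:
  assumes "subspace U" "subspace W" "U \<subseteq> W" "dim W = Suc (dim U)"
  obtains x where "x \<in> W" "x \<notin> U" "span (insert x U) = W"
proof -
  have "U \<noteq> W" using assms(4) by auto
  then obtain x where "x \<in> W" "x \<notin> U" using assms(3) by auto
  then show ?thesis using that span_insert_eq_of_dim assms by blast
qed

lemma obtain_span_singleton:
  assumes "subspace W" "dim W = 1"
  obtains d where "d \<in> W" "d \<noteq> 0" "span {d} = W"
proof (rule obtain_span_insert[of "{0}" W])
  show "dim W = Suc (dim {0})" using assms(2) by simp
  fix x assume "x \<in> W" "x \<notin> {0}" "span {x, 0} = W"
  moreover have "span {x, 0} = span {x}" by (simp only: insert_commute span_insert_0)
  ultimately show ?thesis using that by simp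
qed (use assms subspace_0 in auto)

lemma span_insert_span: "span (insert x (span S)) = span (insert x S)"
  by (simp only: span_insert span_span)

text \<open>One of the functional's values on the two free basis vectors is nonzero; scaling that vector and
  subtracting a multiple of it from the other one leaves the plane spanned by \<open>c\<close> and \<open>d\<close> untouched.\<close>

lemma functional_adapted_basis:
  assumes f: "Vector_Spaces.linear (\<cdot>) (*) f"
    and span: "span {a, b, c, d} = UNIV"
    and "f c = 0" "f d = 0" "f x \<noteq> 0"
  obtains u v where "f u = 1" "f v = 0" "span {u, v, c, d} = UNIV"
proof -
  interpret f: Vector_Spaces.linear "(\<cdot>)" "(*)" f by (rule f)
  have basis: "\<exists>u v. f u = 1 \<and> f v = 0 \<and> span {u, v, c, d} = UNIV"
    if ab: "span {a, b, c, d} = UNIV" and "f a \<noteq> 0" for a b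
  proof -
    define u where "u = (1 / f a) \<cdot> a"
    have fu: "f u = 1" using that by (simp add: u_def f.scale)
    have "span {b, u, c, d} = UNIV"
      using span_replace[OF ab, of "1 / f a" 0] that(2)
      by (simp add: u_def span_zero insert_commute)
    then have "span {b + (- f b) \<cdot> u, u, c, d} = UNIV"
      by (rule span_shift) (simp add: span_base span_neg span_scale)
    then have "span {u, b + (- f b) \<cdot> u, c, d} = UNIV" by (simp only: insert_commute)
    moreover have "f (b + (- f b) \<cdot> u) = 0" using fu by (simp add: f.add f.scale f.neg f.diff)
    ultimately show ?thesis using fu by blast
  qed
  have "f a \<noteq> 0 \<or> f b \<noteq> 0"
  proof (rule ccontr)
    assume "\<not> ?thesis"
    then have "{a, b, c, d} \<subseteq> {x. f x = 0}" using assms by auto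
    then have "span {a, b, c, d} \<subseteq> {x. f x = 0}"
      by (intro span_minimal) (simp_all add: f.subspace_kernel)
    then show False using span \<open>f x \<noteq> 0\<close> by auto
  qed
  moreover have "span {b, a, c, d} = UNIV" using span by (simp only: insert_commute)
  ultimately show ?thesis
    using basis[of a b] basis[of b a] span that by blast
qed

text \<open>In a basis adapted to \<open>f\<close>, independence of \<open>f\<close> and \<open>g\<close> means that \<open>g\<close> does not vanish on the second
  vector, which can then be used to correct the first.\<close>

lemma dual_adapted_basis:
  assumes f: "Vector_Spaces.linear (\<cdot>) (*) f" and g: "Vector_Spaces.linear (\<cdot>) (*) g"
    and span: "span {a, b, c, d} = UNIV"
    and vanish: "f c = 0" "f d = 0" "g c = 0" "g d = 0" and "f x \<noteq> 0"
    and independent: "\<nexists>\<kappa>. \<forall>x. g x = \<kappa> * f x"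
  obtains u v where "f u = 1" "f v = 0" "g u = 0" "g v = 1" "span {u, v, c, d} = UNIV"
proof -
  interpret f: Vector_Spaces.linear "(\<cdot>)" "(*)" f by (rule f)
  interpret g: Vector_Spaces.linear "(\<cdot>)" "(*)" g by (rule g)
  obtain u v where uv: "f u = 1" "f v = 0" "span {u, v, c, d} = UNIV"
    using functional_adapted_basis[OF f span vanish(1,2) \<open>f x \<noteq> 0\<close>] .
  have gv: "g v \<noteq> 0"
  proof
    assume "g v = 0"
    have "subspace {x. g x = g u * f x}"
      by (auto simp: subspace_def f.add f.scale g.add g.scale f.zero g.zero algebra_simps)
    moreover have "{u, v, c, d} \<subseteq> {x. g x = g u * f x}"
      using uv vanish \<open>g v = 0\<close> by auto
    ultimately have "span {u, v, c, d} \<subseteq> {x. g x = g u * f x}" by (intro span_minimal)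
    then show False using independent uv(3) by auto
  qed
  define w where "w = (1 / g v) \<cdot> v"
  have w: "f w = 0" "g w = 1" using uv gv by (simp_all add: w_def f.scale g.scale)
  have "span {v, u, c, d} = UNIV" using uv(3) by (simp add: insert_commute)
  from span_replace[OF this, of "1 / g v" 0] gv
  have "span {u, w, c, d} = UNIV" by (simp add: w_def span_zero insert_commute)
  then have "span {u + (- g u) \<cdot> w, w, c, d} = UNIV"
    by (rule span_shift) (simp add: span_base span_neg span_scale)
  moreover have "f (u + (- g u) \<cdot> w) = 1" "g (u + (- g u) \<cdot> w) = 0"
    using uv w by (simp_all add: f.add g.add f.scale g.scale f.neg g.neg f.diff g.diff)
  ultimately show ?thesis using that w by blast
qed

section \<open>Two generators, a square spanning the second power modulo the third\<close>

text \<open>The parameters \<open>\<alpha>\<close>, \<open>\<beta>\<close> describe the products of \<open>e\<^sub>1\<close> with \<open>e\<^sub>2 = e\<^sub>1 e\<^sub>1\<close>, the parameters \<open>p\<close>, \<open>q\<close>,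
  \<open>s\<close> the products involving the second generator \<open>e\<^sub>3\<close>.\<close>

definition square_type where
  "square_type e1 e2 e3 e4 \<alpha> \<beta> p q s \<longleftrightarrow> has_table [e1, e2, e3, e4]
     [[e2,         \<alpha> \<cdot> e4, p \<cdot> e4, 0],
      [\<beta> \<cdot> e4, 0,          0,       0],
      [q \<cdot> e4, 0,          s \<cdot> e4, 0],
      [0,          0,          0,       0]]"

text \<open>The generators may be moved inside \<open>e\<^sub>1 + \<langle>e\<^sub>3\<rangle>\<close> and \<open>e\<^sub>3 + \<langle>e\<^sub>2\<rangle>\<close>. This changes \<open>(p, q)\<close> by
  \<open>u (s, s) + w (\<alpha>, \<beta>)\<close>, so both can be removed when these two vectors are independent.\<close>

lemma square_type_shift:
  assumes "square_type e1 e2 e3 e4 \<alpha> \<beta> p q s"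
  shows "square_type (e1 + u \<cdot> e3) (e2 + (u * (p + q) + u * u * s) \<cdot> e4) (e3 + w \<cdot> e2) e4
    \<alpha> \<beta> (p + u * s + w * \<alpha>) (q + u * s + w * \<beta>) s"
proof -
  have T: "span {e1, e2, e3, e4} = UNIV" using assms by (simp add: square_type_def has_table_def)
  define c where "c = u * (p + q) + u * u * s"
  from span_shift[OF T, of "u \<cdot> e3"] have "span {e3, e2, e4, e1 + u \<cdot> e3} = UNIV"
    by (simp add: insert_commute span_base span_scale)
  from span_shift[OF this, of "w \<cdot> e2"] have "span {e2, e4, e1 + u \<cdot> e3, e3 + w \<cdot> e2} = UNIV"
    by (simp add: insert_commute span_base span_scale)
  from span_shift[OF this, of "c \<cdot> e4"]
  have "span {e1 + u \<cdot> e3, e2 + c \<cdot> e4, e3 + w \<cdot> e2, e4} = UNIV"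
    by (simp add: insert_commute span_base span_scale)
  then show ?thesis
    using assms unfolding c_def
    by (simp add: square_type_def has_table_def mul_linear scale_right_distrib scale_left_distrib
        algebra_simps)
qed

text \<open>The hypotheses are stated without division, so that each use reduces to polynomial equations.\<close>

lemma square_type_rescale:
  assumes "square_type e1 e2 e3 e4 \<alpha> \<beta> p q s"
    and "a \<noteq> 0" "b \<noteq> 0" "k \<noteq> 0"
    and "a ^ 3 * \<alpha> = k * \<alpha>'" "a ^ 3 * \<beta> = k * \<beta>'" "a * b * p = k * p'" "a * b * q = k * q'"
      "b ^ 2 * s = k * s'"
  shows "square_type (a \<cdot> e1) (a ^ 2 \<cdot> e2) (b \<cdot> e3) (k \<cdot> e4) \<alpha>' \<beta>' p' q' s'"
proof -
  have eqs: "a * a * (a * \<alpha>) = \<alpha>' * k" "a * (a * a * \<beta>) = \<beta>' * k" "b * (a * p) = p' * k"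
    "a * (b * q) = q' * k" "b * (b * s) = s' * k"
    using assms(5-) by (simp_all add: power2_eq_square power3_eq_cube algebra_simps)
  show ?thesis
    using assms(1-4) span_rescale[of e1 e2 e3 e4 a "a ^ 2" b k]
    by (simp add: square_type_def has_table_def mul_linear eqs power2_eq_square)
qed

text \<open>With \<open>p = q = s = 0\<close> the vector \<open>e\<^sub>3\<close> spans a direct summand with zero product, which is the last
  vector of these two tables.\<close>

lemma
  shows square_type_isomorphic_N01: "square_type e1 e2 e3 e4 0 1 0 0 0 \<Longrightarrow> isomorphic_to N01"
    and square_type_isomorphic_N02: "square_type e1 e2 e3 e4 1 \<kappa> 0 0 0 \<Longrightarrow> isomorphic_to (N02 \<kappa>)"
  unfolding N01_def N02_def
  by (rule isomorphic_if_table[of e1 e2 e4 e3],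
      simp add: square_type_def has_table_def table_mult_def axis_def insert_commute)+

lemma
  shows square_type_isomorphic_N04: "square_type e1 e2 e3 e4 1 \<alpha> 0 0 1 \<Longrightarrow> isomorphic_to (N04 \<alpha>)"
    and square_type_isomorphic_N05: "square_type e1 e2 e3 e4 1 1 1 0 1 \<Longrightarrow> isomorphic_to N05"
    and square_type_isomorphic_N06: "square_type e1 e2 e3 e4 1 \<alpha> 1 0 0 \<Longrightarrow> isomorphic_to (N06 \<alpha>)"
    and square_type_isomorphic_N07: "square_type e1 e2 e3 e4 0 1 0 0 1 \<Longrightarrow> isomorphic_to N07"
    and square_type_isomorphic_N08: "square_type e1 e2 e3 e4 0 1 1 0 0 \<Longrightarrow> isomorphic_to N08"
    and square_type_isomorphic_N09: "square_type e1 e2 e3 e4 1 0 0 1 0 \<Longrightarrow> isomorphic_to N09"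
  unfolding N04_def N05_def N06_def N07_def N08_def N09_def
  by (rule isomorphic_if_table[of e1 e2 e3 e4],
      simp add: square_type_def has_table_def table_mult_def axis_def)+

text \<open>After scaling, \<open>\<alpha> = 1\<close>. For \<open>s \<noteq> 0\<close> the shifts act on \<open>(p, q)\<close> through \<open>(1, 1)\<close> and \<open>(1, \<beta>)\<close>,
  so \<open>\<beta> = 1\<close> is the exceptional value, leaving \<open>p - q\<close>; for \<open>s = 0\<close> only the direction \<open>(1, \<beta>)\<close> is
  available, and at most one of \<open>p\<close>, \<open>q\<close> survives.\<close>

lemma square_type_classification_1:
  assumes T: "square_type e1 e2 e3 e4 1 \<beta> p q s"
  shows "isomorphic_to (N02 \<beta>) \<or> isomorphic_to (N04 \<beta>) \<or> isomorphic_to N05 \<or>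
    (\<beta> \<noteq> 0 \<and> isomorphic_to (N06 \<beta>)) \<or> isomorphic_to N09"
proof (cases "s = 0")
  case s: False
  have N04: "isomorphic_to (N04 \<beta>)" if "square_type f1 f2 f3 f4 1 \<beta> 0 0 s" for f1 f2 f3 f4
    by (rule square_type_isomorphic_N04,
        rule square_type_rescale[OF that, where a = 1 and k = 1 and b = "1 / csqrt s"])
      (use s in \<open>simp_all add: power_divide\<close>)
  show ?thesis
  proof (cases "\<beta> = 1")
    case False
    \<comment> \<open>solution of \<open>p + u s + w = q + u s + w \<beta>\<close>; the value of \<open>u\<close> then makes both sides zero\<close>
    define w where "w = (q - p) / (1 - \<beta>)"
    have "w * (1 - \<beta>) = q - p" using False by (simp add: w_def)
    then have "w * \<beta> = w + p - q" by (simp add: algebra_simps)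
    then have "square_type (e1 + (- (p + w) / s) \<cdot> e3)
        (e2 + (- (p + w) / s * (p + q) + - (p + w) / s * (- (p + w) / s) * s) \<cdot> e4)
        (e3 + w \<cdot> e2) e4 1 \<beta> 0 0 s"
      using square_type_shift[OF T, of "- (p + w) / s" w] s by simp
    then show ?thesis using N04 by blast
  next
    case True
    have T': "square_type e1 e2 (e3 + (- q) \<cdot> e2) e4 1 1 (p - q) 0 s"
      using square_type_shift[OF T, of 0 "- q"] True by simp
    show ?thesis
    proof (cases "p = q")
      case True
      then show ?thesis using N04 T' \<open>\<beta> = 1\<close> by auto
    next
      case False
      \<comment> \<open>the unique scaling with \<open>a b P = b\<^sup>2 s = k\<close>, where \<open>k = a\<^sup>3\<close> preserves \<open>\<alpha> = \<beta> = 1\<close>\<close>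
      define P a where "P = p - q" and "a = P ^ 2 / s"
      have nz: "P \<noteq> 0" "a \<noteq> 0" using False s by (simp_all add: P_def a_def)
      have as: "a * s = P ^ 2" using s by (simp add: a_def)
      have "isomorphic_to N05"
        by (rule square_type_isomorphic_N05,
            rule square_type_rescale[OF T'[folded P_def], where a = a and b = "a ^ 2 / P" and k = "a ^ 3"])
          (use nz as in \<open>simp_all add: field_simps power2_eq_square power3_eq_cube\<close>)
      then show ?thesis by blast
    qed
  qed
next
  case s: True
  show ?thesis
  proof (cases "\<beta> = 0")
    case True
    have T': "square_type e1 e2 (e3 + (- p) \<cdot> e2) e4 1 0 0 q 0"
      using square_type_shift[OF T, of 0 "- p"] True s by simp
    show ?thesis
    proof (cases "q = 0")
      case True
      then show ?thesis using T' \<open>\<beta> = 0\<close> square_type_isomorphic_N02 by blast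
    next
      case False
      have "isomorphic_to N09"
        by (rule square_type_isomorphic_N09,
            rule square_type_rescale[OF T', where a = 1 and b = "1 / q" and k = 1])
          (use False in simp_all)
      then show ?thesis by blast
    qed
  next
    case False
    define P where "P = p - q / \<beta>"
    have T': "square_type e1 e2 (e3 + (- (q / \<beta>)) \<cdot> e2) e4 1 \<beta> P 0 0"
      using square_type_shift[OF T, of 0 "- (q / \<beta>)"] False s by (simp add: P_def)
    show ?thesis
    proof (cases "P = 0")
      case True
      then show ?thesis using T' square_type_isomorphic_N02 by blast
    next
      case False
      have "isomorphic_to (N06 \<beta>)"
        by (rule square_type_isomorphic_N06,
            rule square_type_rescale[OF T', where a = 1 and b = "1 / P" and k = 1])
          (use False in simp_all)
      then show ?thesis using \<open>\<beta> \<noteq> 0\<close> by blast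
    qed
  qed
qed

text \<open>Now \<open>\<alpha> = 0\<close> and \<open>\<beta> = 1\<close>: the shift by \<open>w\<close> moves \<open>q\<close> alone, and \<open>p\<close> can be removed by the other
  shift exactly when \<open>s \<noteq> 0\<close>.\<close>

lemma square_type_classification_0:
  assumes T: "square_type e1 e2 e3 e4 0 1 p q s"
  shows "isomorphic_to N01 \<or> isomorphic_to N07 \<or> isomorphic_to N08"
proof (cases "s = 0")
  case s: False
  define u where "u = - p / s"
  have us: "u * s = - p" using s by (simp add: u_def)
  have T': "square_type (e1 + u \<cdot> e3) (e2 + (u * (p + q) + u * u * s) \<cdot> e4) (e3 + (p - q) \<cdot> e2) e4
      0 1 0 0 s"
    using square_type_shift[OF T, of u "p - q"] us by simp
  have "isomorphic_to N07"
    by (rule square_type_isomorphic_N07,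
        rule square_type_rescale[OF T', where a = 1 and k = 1 and b = "1 / csqrt s"])
      (use s in \<open>simp_all add: power_divide\<close>)
  then show ?thesis by blast
next
  case s: True
  have T': "square_type e1 e2 (e3 + (- q) \<cdot> e2) e4 0 1 p 0 0"
    using square_type_shift[OF T, of 0 "- q"] s by simp
  show ?thesis
  proof (cases "p = 0")
    case True
    then show ?thesis using T' square_type_isomorphic_N01 by blast
  next
    case False
    have "isomorphic_to N08"
      by (rule square_type_isomorphic_N08,
          rule square_type_rescale[OF T', where a = 1 and b = "1 / p" and k = 1])
        (use False in simp_all)
    then show ?thesis by blast
  qed
qed

proposition square_type_classification:
  assumes T: "square_type e1 e2 e3 e4 \<alpha> \<beta> p q s" and "\<alpha> \<noteq> 0 \<or> \<beta> \<noteq> 0"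
  shows "isomorphic_to N01 \<or> (\<exists>\<kappa>. isomorphic_to (N02 \<kappa>)) \<or> (\<exists>\<alpha>. isomorphic_to (N04 \<alpha>)) \<or>
    isomorphic_to N05 \<or> (\<exists>\<alpha>. \<alpha> \<noteq> 0 \<and> isomorphic_to (N06 \<alpha>)) \<or>
    isomorphic_to N07 \<or> isomorphic_to N08 \<or> isomorphic_to N09"
proof (cases "\<alpha> = 0")
  case True
  with assms have "square_type (1 \<cdot> e1) (1 ^ 2 \<cdot> e2) (1 \<cdot> e3) (\<beta> \<cdot> e4) 0 1 (p / \<beta>) (q / \<beta>) (s / \<beta>)"
    by (intro square_type_rescale[OF T]) auto
  from square_type_classification_0[OF this] show ?thesis by blast
next
  case False
  then have "square_type (1 \<cdot> e1) (1 ^ 2 \<cdot> e2) (1 \<cdot> e3) (\<alpha> \<cdot> e4)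
      1 (\<beta> / \<alpha>) (p / \<alpha>) (q / \<alpha>) (s / \<alpha>)"
    by (intro square_type_rescale[OF T]) auto
  from square_type_classification_1[OF this] show ?thesis by blast
qed

section \<open>Two generators, a mixed product spanning the second power modulo the third\<close>

text \<open>Here \<open>t\<close> and \<open>m\<close> describe the products of the generators with \<open>e\<^sub>3 = e\<^sub>1 e\<^sub>2\<close>. One table serves for the
  two families \<open>m = 0\<close> and \<open>m \<noteq> 0\<close>.\<close>

definition mixed_type where
  "mixed_type e1 e2 e3 e4 p q s t m \<longleftrightarrow> has_table [e1, e2, e3, e4]
     [[p \<cdot> e4, e3,           t \<cdot> e4, 0],
      [q \<cdot> e4, s \<cdot> e4,     m \<cdot> e4, 0],
      [0,       (- m) \<cdot> e4, 0,       0],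
      [0,       0,            0,       0]]"

text \<open>Moving \<open>e\<^sub>1\<close> inside \<open>e\<^sub>1 + \<langle>e\<^sub>3\<rangle>\<close> changes \<open>(p, q)\<close> by a multiple of \<open>(t, m)\<close>: it removes \<open>q\<close> when
  \<open>m \<noteq> 0\<close>, and \<open>p\<close> when \<open>m = 0\<close>.\<close>

lemma mixed_type_shift:
  assumes "mixed_type e1 e2 e3 e4 p q s t m"
  shows "mixed_type (e1 + w \<cdot> e3) e2 (e3 + (- (w * m)) \<cdot> e4) e4 (p + w * t) (q + w * m) s t m"
proof -
  have T: "span {e1, e2, e3, e4} = UNIV" using assms by (simp add: mixed_type_def has_table_def)
  from span_shift[OF T, of "w \<cdot> e3"] have "span {e3, e2, e4, e1 + w \<cdot> e3} = UNIV"
    by (simp add: insert_commute span_base span_scale)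
  from span_shift[OF this, of "(- (w * m)) \<cdot> e4"]
  have "span {e1 + w \<cdot> e3, e2, e3 + (- (w * m)) \<cdot> e4, e4} = UNIV"
    by (simp add: insert_commute span_base span_scale span_neg)
  then show ?thesis
    using assms
    by (simp add: mixed_type_def has_table_def mul_linear scale_right_distrib scale_left_distrib
        algebra_simps)
qed

lemma mixed_type_rescale:
  assumes "mixed_type e1 e2 e3 e4 p q s t m"
    and "a \<noteq> 0" "b \<noteq> 0" "k \<noteq> 0"
    and "a ^ 2 * p = k * p'" "a * b * q = k * q'" "b ^ 2 * s = k * s'"
      "a ^ 2 * b * t = k * t'" "a * b ^ 2 * m = k * m'"
  shows "mixed_type (a \<cdot> e1) (b \<cdot> e2) ((a * b) \<cdot> e3) (k \<cdot> e4) p' q' s' t' m'"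
proof -
  have eqs: "a * (a * p) = p' * k" "a * (b * q) = q' * k" "b * (b * s) = s' * k"
    "a * b * (a * t) = t' * k" "a * b * (b * m) = m' * k" "b * (a * b * m) = m' * k"
    using assms(5-) by (simp_all add: power2_eq_square power3_eq_cube algebra_simps)
  show ?thesis
    using assms(1-4) span_rescale[of e1 e2 e3 e4 a b "a * b" k]
    by (simp add: mixed_type_def has_table_def mul_linear eqs power2_eq_square)
qed

lemma mixed_type_isomorphic:
  shows "mixed_type e1 e2 e3 e4 0 0 0 1 0 \<Longrightarrow> isomorphic_to N10"
    and "mixed_type e1 e2 e3 e4 0 1 0 1 0 \<Longrightarrow> isomorphic_to N11"
    and "mixed_type e1 e2 e3 e4 0 0 0 0 1 \<Longrightarrow> isomorphic_to N12"
    and "mixed_type e1 e2 e3 e4 1 0 0 0 1 \<Longrightarrow> isomorphic_to N13"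
    and "mixed_type e1 e2 e3 e4 0 0 0 1 1 \<Longrightarrow> isomorphic_to N14"
    and "mixed_type e1 e2 e3 e4 1 0 0 1 1 \<Longrightarrow> isomorphic_to N15"
    and "mixed_type e1 e2 e3 e4 0 0 1 1 0 \<Longrightarrow> isomorphic_to N16"
    and "mixed_type e1 e2 e3 e4 0 1 1 1 0 \<Longrightarrow> isomorphic_to N17"
    and "mixed_type e1 e2 e3 e4 0 0 1 0 1 \<Longrightarrow> isomorphic_to N18"
    and "mixed_type e1 e2 e3 e4 1 0 1 0 1 \<Longrightarrow> isomorphic_to N19"
    and "mixed_type e1 e2 e3 e4 \<alpha> 0 1 1 1 \<Longrightarrow> isomorphic_to (N20 \<alpha>)"
  unfolding N10_def N11_def N12_def N13_def N14_def N15_def N16_def N17_def N18_def N19_def N20_def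
  by (rule isomorphic_if_table[of e1 e2 e3 e4],
      simp add: mixed_type_def has_table_def table_mult_def axis_def)+

text \<open>The scaling has two free parameters after \<open>t\<close> is normalised: \<open>q\<close> becomes \<open>q / (a t)\<close> and \<open>s\<close> becomes
  \<open>b s / (a\<^sup>2 t)\<close>, so both can be brought to 0 or 1 independently.\<close>

lemma mixed_type_classification_0:
  assumes T: "mixed_type e1 e2 e3 e4 p q s t 0" and t: "t \<noteq> 0"
  shows "isomorphic_to N10 \<or> isomorphic_to N11 \<or> isomorphic_to N16 \<or> isomorphic_to N17"
proof -
  define \<delta> where "\<delta> c = (if c = 0 then 0 else 1 :: complex)" for c :: complex
  define a where "a = (if q = 0 then 1 else q / t)"
  define b where "b = (if s = 0 then 1 else a ^ 2 * t / s)"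
  have nz: "a \<noteq> 0" "b \<noteq> 0" using t by (simp_all add: a_def b_def)
  have "a * b * q = a ^ 2 * b * t * \<delta> q" "b ^ 2 * s = a ^ 2 * b * t * \<delta> s"
    using t nz by (auto simp: a_def b_def \<delta>_def power2_eq_square)
  moreover have "mixed_type (e1 + (- p / t) \<cdot> e3) e2 (e3 + (- (- p / t * 0)) \<cdot> e4) e4 0 q s t 0"
    using mixed_type_shift[OF T, of "- p / t"] t by simp
  ultimately have "mixed_type (a \<cdot> (e1 + (- p / t) \<cdot> e3)) (b \<cdot> e2)
      ((a * b) \<cdot> (e3 + (- (- p / t * 0)) \<cdot> e4)) ((a ^ 2 * b * t) \<cdot> e4) 0 (\<delta> q) (\<delta> s) 1 0"
    using nz t by (intro mixed_type_rescale[where a = a and b = b and k = "a ^ 2 * b * t"]) auto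
  then show ?thesis
    by (auto simp: \<delta>_def split: if_splits dest: mixed_type_isomorphic)
qed

text \<open>Once \<open>q = 0\<close> and \<open>m = 1\<close>, the scaling turns \<open>(p, s, t)\<close> into
  \<open>(a p / (b\<^sup>2 m), s / (a m), a t / (b m))\<close>. For \<open>t = 0\<close> the choice of \<open>a\<close> normalises \<open>s\<close> and a square
  root \<open>b\<close> normalises \<open>p\<close>. For \<open>t \<noteq> 0\<close> the choice \<open>b = a t / m\<close> is forced, \<open>a\<close> is the only freedom left
  for \<open>p\<close> and \<open>s\<close>, and \<open>p m\<^sup>2 / (s t\<^sup>2)\<close> is the parameter of the remaining family.\<close>

lemma mixed_type_classification_1:
  assumes T0: "mixed_type e1 e2 e3 e4 p q s t m" and m: "m \<noteq> 0"
  shows "isomorphic_to N12 \<or> isomorphic_to N13 \<or> isomorphic_to N14 \<or> isomorphic_to N15 \<or>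
    isomorphic_to N18 \<or> isomorphic_to N19 \<or> (\<exists>\<alpha>. isomorphic_to (N20 \<alpha>))"
proof -
  obtain f1 f2 f3 p where T: "mixed_type f1 f2 f3 e4 p 0 s t m"
    using mixed_type_shift[OF T0, of "- q / m"] m by auto
  have rescaled: "\<exists>g1 g2 g3 g4. mixed_type g1 g2 g3 g4 p' 0 s' t' 1"
    if "a \<noteq> 0" "b \<noteq> 0" "a * p = b ^ 2 * m * p'" "s = a * m * s'" "a * t = b * m * t'" for a b p' s' t'
  proof -
    have "mixed_type (a \<cdot> f1) (b \<cdot> f2) ((a * b) \<cdot> f3) ((a * b ^ 2 * m) \<cdot> e4) p' 0 s' t' 1"
      using that m by (intro mixed_type_rescale[OF T]) (simp_all add: power2_eq_square ac_simps)
    then show ?thesis by blast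
  qed
  show ?thesis
  proof (cases "t = 0")
    case t: True
    define a where "a = (if s = 0 then 1 else s / m)"
    define b where "b = (if p = 0 then 1 else csqrt (a * p / m))"
    define \<delta> where "\<delta> c = (if c = 0 then 0 else 1 :: complex)" for c :: complex
    have "a \<noteq> 0" "b \<noteq> 0" using m by (simp_all add: a_def b_def)
    moreover have "a * p = b ^ 2 * m * \<delta> p" "s = a * m * \<delta> s"
      using m by (auto simp: a_def b_def \<delta>_def)
    ultimately have "\<exists>g1 g2 g3 g4. mixed_type g1 g2 g3 g4 (\<delta> p) 0 (\<delta> s) 0 1"
      using t by (intro rescaled[of a b]) auto
    then show ?thesis
      by (auto simp: \<delta>_def split: if_splits dest: mixed_type_isomorphic)
  next
    case t: False
    have rescaled': "\<exists>g1 g2 g3 g4. mixed_type g1 g2 g3 g4 p' 0 s' 1 1"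
      if "a \<noteq> 0" "p * m = a * t ^ 2 * p'" "s = a * m * s'" for a p' s'
    proof (rule rescaled[of a "a * t / m"])
      show "a * p = (a * t / m) ^ 2 * m * p'"
        using that(1,2) m by (simp add: field_simps power2_eq_square)
    qed (use that m t in simp_all)
    show ?thesis
    proof (cases "s = 0")
      case s: False
      have "\<exists>g1 g2 g3 g4. mixed_type g1 g2 g3 g4 (p * m ^ 2 / (s * t ^ 2)) 0 1 1 1"
        using s m t by (intro rescaled'[of "s / m"]) (simp_all add: power2_eq_square)
      then show ?thesis using mixed_type_isomorphic(11) by blast
    next
      case s: True
      show ?thesis
      proof (cases "p = 0")
        case True
        with s have "\<exists>g1 g2 g3 g4. mixed_type g1 g2 g3 g4 0 0 0 1 1"
          by (intro rescaled'[of 1]) simp_all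
        then show ?thesis using mixed_type_isomorphic(5) by blast
      next
        case False
        with s m t have "\<exists>g1 g2 g3 g4. mixed_type g1 g2 g3 g4 1 0 0 1 1"
          by (intro rescaled'[of "p * m / t ^ 2"]) simp_all
        then show ?thesis using mixed_type_isomorphic(6) by blast
      qed
    qed
  qed
qed

proposition mixed_type_classification:
  assumes T: "mixed_type e1 e2 e3 e4 p q s t m" and "t \<noteq> 0 \<or> m \<noteq> 0"
  shows "isomorphic_to N10 \<or> isomorphic_to N11 \<or> isomorphic_to N12 \<or> isomorphic_to N13 \<or>
    isomorphic_to N14 \<or> isomorphic_to N15 \<or> isomorphic_to N16 \<or> isomorphic_to N17 \<or>
    isomorphic_to N18 \<or> isomorphic_to N19 \<or> (\<exists>\<alpha>. isomorphic_to (N20 \<alpha>))"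
proof (cases "m = 0")
  case True
  then show ?thesis using mixed_type_classification_0 assms by blast
next
  case False
  from mixed_type_classification_1[OF T this] show ?thesis by blast
qed

section \<open>One generator\<close>

text \<open>The one-generated algebras with \<open>A\<^sup>4 \<noteq> 0\<close> and \<open>e\<^sub>1 e\<^sub>2 \<notin> A\<^sup>4\<close>. The coefficients \<open>2 - \<kappa>\<close> and \<open>\<kappa>\<close> are the
  ones that the Novikov identities force, for a suitable choice of \<open>e\<^sub>4\<close>.\<close>

definition cyclic_type where
  "cyclic_type e1 e2 e3 e4 \<kappa> \<nu> \<longleftrightarrow> has_table [e1, e2, e3, e4]
     [[e2,                       e3,         (2 - \<kappa>) \<cdot> e4, 0],
      [\<kappa> \<cdot> e3 + \<nu> \<cdot> e4, \<kappa> \<cdot> e4, 0,                 0],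
      [\<kappa> \<cdot> e4,              0,          0,                 0],
      [0,                        0,          0,                 0]]"

text \<open>The vectors other than \<open>e\<^sub>1\<close> are recomputed as \<open>e\<^sub>2 = e\<^sub>1 e\<^sub>1\<close> and \<open>e\<^sub>3 = e\<^sub>1 e\<^sub>2\<close> from the new
  generator. The effect on \<open>\<nu>\<close> vanishes exactly for \<open>\<kappa> = 0\<close> and \<open>\<kappa> = 1\<close>, which is why these two values
  contribute additional algebras.\<close>

lemma cyclic_type_shift:
  assumes "cyclic_type e1 e2 e3 e4 \<kappa> \<nu>"
  shows "cyclic_type (e1 + x \<cdot> e2) (e2 + ((x * (1 + \<kappa>)) \<cdot> e3 + (x * \<nu> + x * x * \<kappa>) \<cdot> e4))
    (e3 + (x * (1 + \<kappa>) * (2 - \<kappa>) + x * \<kappa>) \<cdot> e4) e4 \<kappa> (\<nu> + x * \<kappa> ^ 2 * (\<kappa> - 1))"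
proof -
  have T: "span {e1, e2, e3, e4} = UNIV" using assms by (simp add: cyclic_type_def has_table_def)
  let ?a = "e1 + x \<cdot> e2" and ?b = "e2 + ((x * (1 + \<kappa>)) \<cdot> e3 + (x * \<nu> + x * x * \<kappa>) \<cdot> e4)"
    and ?c = "e3 + (x * (1 + \<kappa>) * (2 - \<kappa>) + x * \<kappa>) \<cdot> e4"
  have "span {e2, e3, e4, ?a} = UNIV"
    using span_shift[OF T, of "x \<cdot> e2"] by (simp add: insert_commute span_base span_scale)
  then have "span {e3, e4, ?a, ?b} = UNIV"
    using span_shift[of e2 "{e3, e4, ?a}" "(x * (1 + \<kappa>)) \<cdot> e3 + (x * \<nu> + x * x * \<kappa>) \<cdot> e4"]
    by (simp add: insert_commute span_base span_scale span_add)
  then have "span {e4, ?a, ?b, ?c} = UNIV"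
    using span_shift[of e3 "{e4, ?a, ?b}" "(x * (1 + \<kappa>) * (2 - \<kappa>) + x * \<kappa>) \<cdot> e4"]
    by (simp add: insert_commute span_base span_scale)
  then have "span {?a, ?b, ?c, e4} = UNIV" by (simp add: insert_commute)
  then show ?thesis
    by (simp add: cyclic_type_def has_table_def mul_linear scale_right_distrib scale_left_distrib
        assms[unfolded cyclic_type_def has_table_def, simplified]
        scale_left_diff_distrib scale_right_diff_distrib algebra_simps power2_eq_square)
      (simp add: algebra_simps flip: scale_left_distrib)
qed

proposition cyclic_type_classification:
  assumes T: "cyclic_type e1 e2 e3 e4 \<kappa> \<nu>"
  shows "isomorphic_to (N22 \<kappa>) \<or> isomorphic_to N23 \<or> isomorphic_to N24"
proof -
  have N22: "isomorphic_to (N22 \<kappa>)" if "cyclic_type f1 f2 f3 f4 \<kappa> 0" for f1 f2 f3 f4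
    using that unfolding N22_def
    by (intro isomorphic_if_table[of f1 f2 f3 f4])
      (simp add: cyclic_type_def has_table_def table_mult_def axis_def)
  \<comment> \<open>the generator is scaled by \<open>\<nu>\<close>, hence products of \<open>k\<close> factors by \<open>\<nu>\<^sup>k\<close>\<close>
  have rescaled: "cyclic_type (\<nu> \<cdot> e1) (\<nu> ^ 2 \<cdot> e2) (\<nu> ^ 3 \<cdot> e3) (\<nu> ^ 4 \<cdot> e4) \<kappa> 1" if "\<nu> \<noteq> 0"
    using T that span_rescale[of e1 e2 e3 e4 \<nu> "\<nu> ^ 2" "\<nu> ^ 3" "\<nu> ^ 4"]
    by (simp add: cyclic_type_def has_table_def mul_linear scale_right_distrib
        power2_eq_square power3_eq_cube power4_eq_xxxx ac_simps)
  consider "\<nu> = 0" | "\<kappa> = 0" "\<nu> \<noteq> 0" | "\<kappa> = 1" "\<nu> \<noteq> 0" | "\<kappa> \<noteq> 0" "\<kappa> \<noteq> 1" by blast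
  then show ?thesis
  proof cases
    case 1
    then show ?thesis using T N22 by blast
  next
    case 2
    then have "isomorphic_to N23"
      using rescaled unfolding N23_def
      by (intro isomorphic_if_table[of "\<nu> \<cdot> e1" "\<nu> ^ 2 \<cdot> e2" "\<nu> ^ 3 \<cdot> e3" "\<nu> ^ 4 \<cdot> e4"])
        (simp add: cyclic_type_def has_table_def table_mult_def axis_def)
    then show ?thesis by blast
  next
    case 3
    then have "isomorphic_to N24"
      using rescaled unfolding N24_def
      by (intro isomorphic_if_table[of "\<nu> \<cdot> e1" "\<nu> ^ 2 \<cdot> e2" "\<nu> ^ 3 \<cdot> e3" "\<nu> ^ 4 \<cdot> e4"])
        (simp add: cyclic_type_def has_table_def table_mult_def axis_def)
    then show ?thesis by blast
  next
    case 4
    then show ?thesis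
      using N22 cyclic_type_shift[OF T, of "- \<nu> / (\<kappa> ^ 2 * (\<kappa> - 1))"] by simp
  qed
qed

text \<open>The remaining one-generated algebras, with \<open>e\<^sub>1 e\<^sub>2 \<in> A\<^sup>4\<close>: replacing the generator by \<open>e\<^sub>1 - \<mu> e\<^sub>2\<close>
  removes \<open>\<mu>\<close>.\<close>

lemma isomorphic_N21:
  assumes "has_table [e1, e2, e3, e4]
     [[e2,           \<mu> \<cdot> e4, e4, 0],
      [e3,           0,         0,  0],
      [(- 1) \<cdot> e4, 0,         0,  0],
      [0,            0,         0,  0]]"
  shows "isomorphic_to N21"
proof -
  have T: "span {e1, e2, e3, e4} = UNIV" using assms by (simp add: has_table_def)
  let ?a = "e1 + (- \<mu>) \<cdot> e2" and ?b = "e2 + ((- \<mu>) \<cdot> e3 + (- \<mu> * \<mu>) \<cdot> e4)"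
    and ?c = "e3 + \<mu> \<cdot> e4"
  have "span {e2, e3, e4, ?a} = UNIV"
    using span_shift[OF T, of "(- \<mu>) \<cdot> e2"] by (simp add: insert_commute span_base span_scale span_neg)
  then have "span {e3, e4, ?a, ?b} = UNIV"
    using span_shift[of e2 "{e3, e4, ?a}" "(- \<mu>) \<cdot> e3 + (- \<mu> * \<mu>) \<cdot> e4"]
    by (simp add: insert_commute span_base span_scale span_add span_neg span_diff)
  then have "span {e4, ?a, ?b, ?c} = UNIV"
    using span_shift[of e3 "{e4, ?a, ?b}" "\<mu> \<cdot> e4"]
    by (simp add: insert_commute span_base span_scale)
  then have "span {?a, ?b, ?c, e4} = UNIV" by (simp add: insert_commute)
  then show ?thesis
    using assms unfolding N21_def
    by (intro isomorphic_if_table[of ?a ?b ?c e4])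
      (simp add: has_table_def table_mult_def axis_def mul_linear scale_right_distrib
        scale_left_distrib algebra_simps)
qed

lemma isomorphic_N03:
  assumes "has_table [e1, e2, e3, e4] [[e2, e4, 0, 0], [e3, 0, 0, 0], [0, 0, 0, 0], [0, 0, 0, 0]]"
  shows "isomorphic_to N03"
  using assms unfolding N03_def
  by (intro isomorphic_if_table[of e1 e2 e3 e4])
    (simp add: has_table_def table_mult_def axis_def)

end

section \<open>The powers of a nilpotent Novikov algebra\<close>

locale nilpotent_novikov4 =
  novikov_algebra scale mul + algebra4 scale mul Basis
  for scale :: "complex \<Rightarrow> 'a::ab_group_add \<Rightarrow> 'a" (infixr "\<cdot>" 75)
    and mul :: "'a \<Rightarrow> 'a \<Rightarrow> 'a" (infixl "\<star>" 70)
    and Basis :: "'a set" +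
  assumes nilpotent: "nilpotent_algebra mul"
begin

text \<open>The index is shifted by one: \<open>lcs n\<close> is \<open>A\<^sup>n\<^sup>+\<^sup>1\<close>, so \<open>lcs 1 = A\<^sup>2\<close>. By analogy with Lie algebras
  this is the lower central series.\<close>

fun lcs :: "nat \<Rightarrow> 'a set" where
  "lcs 0 = UNIV"
| "lcs (Suc n) = span {z. \<exists>x. \<exists>y\<in>lcs n. z = x \<star> y \<or> z = y \<star> x}"

declare lcs.simps(2) [simp del]

lemma subspace_lcs: "subspace (lcs n)"
  by (cases n) (simp_all add: lcs.simps(2))

lemma span_lcs [simp]: "span (lcs n) = lcs n"
  using subspace_lcs span_eq_iff by blast

lemma mul_in_lcs:
  assumes "y \<in> lcs n"
  shows "x \<star> y \<in> lcs (Suc n)" and "y \<star> x \<in> lcs (Suc n)"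
  using assms by (auto simp: lcs.simps(2) intro: span_base)

lemma lcs_Suc_subset:
  assumes "subspace S" and "\<And>x y. y \<in> lcs n \<Longrightarrow> x \<star> y \<in> S" and "\<And>x y. y \<in> lcs n \<Longrightarrow> y \<star> x \<in> S"
  shows "lcs (Suc n) \<subseteq> S"
  unfolding lcs.simps(2) using assms by (intro span_minimal) auto

lemma lcs_decreasing: "lcs (Suc n) \<subseteq> lcs n"
proof (induction n)
  case (Suc n)
  show ?case
    by (rule lcs_Suc_subset[OF subspace_lcs]) (use Suc mul_in_lcs in blast)+
qed simp

lemma zero_in_lcs [simp]: "0 \<in> lcs n"
  using subspace_lcs subspace_0 by blast

lemma dim_lcs_eq_0: "dim (lcs n) = 0 \<longleftrightarrow> lcs n = {0}"
  unfolding dim_eq_0 using zero_in_lcs[of n] by blast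

text \<open>If \<open>A\<^sup>n\<^sup>+\<^sup>1\<close> is spanned by products of its own elements with others, then by iteration it is spanned by
  arbitrarily long products, all of which vanish.\<close>

lemma lcs_stationary:
  assumes "lcs (Suc n) = lcs n"
  shows "lcs n = {0}"
proof -
  have long: "lcs n \<subseteq> span {x. bracketed_product mul (Suc k) x}" for k
  proof (induction k)
    case 0
    have "span {x. bracketed_product mul (Suc 0) x} = UNIV"
      using bracketed_product.single[of mul] by simp
    then show ?case by simp
  next
    case (Suc k)
    let ?P = "\<lambda>k. {x. bracketed_product mul k x}"
    have one: "bracketed_product mul 1 x" for x by (rule bracketed_product.single)
    have left: "x \<star> y \<in> span (?P (Suc (Suc k)))" and right: "y \<star> x \<in> span (?P (Suc (Suc k)))"
      if "y \<in> span (?P (Suc k))" for x y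
      using that
    proof (induction y rule: span_induct_alt)
      case base
      case 1 show ?case by (simp add: span_zero)
      case 2 show ?case by (simp add: span_zero)
    next
      case (step c y z)
      have "bracketed_product mul (Suc (Suc k)) (x \<star> y)" "bracketed_product mul (Suc (Suc k)) (y \<star> x)"
        using bracketed_product.times[OF one, of "Suc k" y x]
          bracketed_product.times[OF _ one, of "Suc k" y x] step by simp_all
      then show "x \<star> (c \<cdot> y + z) \<in> span (?P (Suc (Suc k)))" "(c \<cdot> y + z) \<star> x \<in> span (?P (Suc (Suc k)))"
        using step by (simp_all add: mul_linear span_add span_scale span_base)
    qed
    have "lcs (Suc n) \<subseteq> span (?P (Suc (Suc k)))"
      by (rule lcs_Suc_subset) (use left right Suc in auto)
    then show ?case using assms by simp
  qed
  obtain k where "k \<ge> 1" "\<And>x. bracketed_product mul k x \<Longrightarrow> x = 0"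
    using nilpotent by (auto simp: nilpotent_algebra_def)
  then have "{x. bracketed_product mul (Suc (k - 1)) x} \<subseteq> {0}" by auto
  then have "span {x. bracketed_product mul (Suc (k - 1)) x} \<subseteq> {0}"
    by (intro span_minimal) (simp_all add: subspace_def)
  then show ?thesis using long[of "k - 1"] by auto
qed

lemma dim_lcs_less:
  assumes "lcs n \<noteq> {0}"
  shows "dim (lcs (Suc n)) < dim (lcs n)"
  using assms lcs_stationary[of n] lcs_decreasing[of n] by (intro dim_psubset) auto

text \<open>Right commutativity moves the factor from \<open>A\<^sup>k\<close> next to \<open>u\<close>: \<open>(uv)y = (uy)v\<close>.\<close>

lemma lcs1_lcs_mul:
  assumes "x \<in> lcs 1" and "y \<in> lcs n"
  shows "x \<star> y \<in> lcs (Suc (Suc n))"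
proof -
  have "(u \<star> v) \<star> y \<in> lcs (Suc (Suc n))" for u v
    using mul_in_lcs(2)[OF mul_in_lcs(1)[OF assms(2)], of u v] by (simp add: right_commutative)
  then have "lcs (Suc 0) \<subseteq> {x. x \<star> y \<in> lcs (Suc (Suc n))}"
    using subspace_lcs
    by (intro lcs_Suc_subset) (auto simp: subspace_def mul_linear)
  then show ?thesis using assms(1) by auto
qed

text \<open>The mirror image of the preceding lemma, here for \<open>A\<^sup>3 A\<^sup>2 \<subseteq> A\<^sup>5\<close>. Products \<open>(yx)z\<close> with
  \<open>y, z \<in> A\<^sup>2\<close> are handled by right commutativity; left symmetry expresses \<open>(xy)z\<close> by them and by products
  that the preceding lemma covers.\<close>

lemma lcs2_lcs1_mul:
  assumes "x \<in> lcs 2" and "z \<in> lcs 1"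
  shows "x \<star> z \<in> lcs 4"
proof -
  note add = subspace_add[OF subspace_lcs] and diff = subspace_diff[OF subspace_lcs]
  have sub: "subspace {x. x \<star> z \<in> lcs 4}"
    using subspace_lcs by (auto simp: subspace_def mul_linear)
  have left: "(y \<star> x) \<star> z \<in> lcs 4" and right: "(x \<star> y) \<star> z \<in> lcs 4" if "y \<in> lcs 1" for x y
  proof -
    have yz: "y \<star> z \<in> lcs 3" using lcs1_lcs_mul[OF that assms(2)] by (simp add: numeral_eq_Suc)
    show yxz: "(y \<star> x) \<star> z \<in> lcs 4"
      using mul_in_lcs(2)[OF yz, of x] right_commutative[of y x z] by (simp add: numeral_eq_Suc)
    have "x \<star> z \<in> lcs 2" using mul_in_lcs(1)[OF assms(2)] by (simp add: numeral_eq_Suc)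
    then have "y \<star> (x \<star> z) \<in> lcs 4" using lcs1_lcs_mul[OF that, of _ 2] by (simp add: numeral_eq_Suc)
    moreover have "x \<star> (y \<star> z) \<in> lcs 4" using mul_in_lcs(1)[OF yz] by (simp add: numeral_eq_Suc)
    moreover have "(x \<star> y) \<star> z = (y \<star> x) \<star> z - y \<star> (x \<star> z) + x \<star> (y \<star> z)"
      using left_symmetric[of x y z] by (simp add: algebra_simps)
    ultimately show "(x \<star> y) \<star> z \<in> lcs 4" using yxz add diff by simp
  qed
  have "lcs (Suc 1) \<subseteq> {x. x \<star> z \<in> lcs 4}"
    by (rule lcs_Suc_subset[OF sub]) (use left right in auto)
  then show ?thesis using assms(1) by (auto simp: numeral_2_eq_2)
qed

lemma lcs_2_nonzero:
  assumes "pure_algebra (\<star>)"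
  shows "lcs 2 \<noteq> {0}"
proof
  assume zero: "lcs 2 = {0}"
  have "x \<star> y \<in> lcs 1" for x y using mul_in_lcs(1)[of y 0 x] by simp
  from mul_in_lcs[OF this] have "z \<star> (x \<star> y) = 0" "(x \<star> y) \<star> z = 0" for x y z
    using zero by (simp_all add: numeral_2_eq_2)
  then show False using assms by (simp add: pure_algebra_def)
qed

section \<open>Structure of the two-generated algebras\<close>

text \<open>The heart of the two-generated case. Comparing coefficients of \<open>d\<close>, the Novikov identities read
  \<open>B(x,y) r(z) = B(x,z) r(y)\<close> and \<open>B(x,y) r(z) - B(y,z) l(x) = B(y,x) r(z) - B(x,z) l(y)\<close>. If \<open>r \<noteq> 0\<close>,
  the first factors \<open>B = f \<otimes> r\<close>, and the second says that \<open>f \<otimes> (r + l)\<close> is symmetric, whence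
  \<open>r + l = t f\<close>. If \<open>r = 0\<close>, the second factors \<open>B = l \<otimes> g\<close>. Both solutions have the form
  \<open>B = f \<otimes> g\<close>, \<open>r = m g\<close>, \<open>l = t f - m g\<close>. As \<open>f\<close> and \<open>g\<close> vanish on \<open>c\<close> and \<open>d\<close>, the generators can be
  adapted to them.\<close>

lemma two_generators:
  assumes span: "span {a, b, c, d} = UNIV" and c: "c \<notin> span {d}" and d: "d \<noteq> 0"
    and zero: "\<And>x. x \<star> d = 0" "\<And>x. d \<star> x = 0" "c \<star> c = 0"
    and products: "\<And>x y. x \<star> y = B x y \<cdot> c + Q x y \<cdot> d"
    and l: "\<And>x. x \<star> c = l x \<cdot> d" and r: "\<And>x. c \<star> x = r x \<cdot> d"
    and nontrivial: "B x0 y0 \<noteq> 0" "l x1 \<noteq> 0 \<or> r x1 \<noteq> 0"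
  shows "(\<exists>e1 e2 e3 e4 \<alpha> \<beta> p q s. square_type e1 e2 e3 e4 \<alpha> \<beta> p q s \<and> (\<alpha> \<noteq> 0 \<or> \<beta> \<noteq> 0)) \<or>
    (\<exists>e1 e2 e3 e4 p q s t m. mixed_type e1 e2 e3 e4 p q s t m \<and> (t \<noteq> 0 \<or> m \<noteq> 0))"
proof -
  have unique: "k = k' \<and> j = j'" if "k \<cdot> c + j \<cdot> d = k' \<cdot> c + j' \<cdot> d" for k j k' j'
  proof -
    have eq: "(k - k') \<cdot> c = (j' - j) \<cdot> d"
      using that by (simp add: scale_left_diff_distrib algebra_simps)
    have "k = k'"
    proof (rule ccontr)
      assume "k \<noteq> k'"
      then have "c = inverse (k - k') \<cdot> ((k - k') \<cdot> c)" by simp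
      also have "\<dots> \<in> span {d}" unfolding eq by (intro span_scale span_base) simp
      finally show False using c by simp
    qed
    with eq d show ?thesis by simp
  qed
  have coeff: "B x y = k" if "x \<star> y = k \<cdot> c + j \<cdot> d" for x y k j
    using unique[of "B x y" "Q x y" k j] that products[of x y] by simp
  have coeff_d: "k = j" if "k \<cdot> d = j \<cdot> d" for k j using that d by simp
  have linear: "Vector_Spaces.linear (\<cdot>) (*) h"
    if "\<And>x y. h (x + y) = h x + h y" "\<And>k x. h (k \<cdot> x) = k * h x" for h :: "'a \<Rightarrow> complex"
    using that vector_space_axioms vector_space_over_itself.vector_space_axioms
    by (simp add: Vector_Spaces.linear_iff)
  have l_add: "l (x + y) = l x + l y" and r_add: "r (x + y) = r x + r y"
    and l_scale: "l (k \<cdot> x) = k * l x" and r_scale: "r (k \<cdot> x) = k * r x" for x y k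
    by (rule coeff_d; simp add: l[symmetric] r[symmetric] mul_linear scale_left_distrib
        flip: scale_scale)+
  have l_c: "l c = 0" and l_d: "l d = 0" and r_c: "r c = 0" and r_d: "r d = 0"
    using l[of c] l[of d] r[of c] r[of d] zero d by auto
  have B_add: "B (x + y) z = B x z + B y z" "B z (x + y) = B z x + B z y" for x y z
    by (rule coeff[where j = "Q x z + Q y z"],
        simp add: mul_linear products[of x z] products[of y z] scale_left_distrib,
        rule coeff[where j = "Q z x + Q z y"],
        simp add: mul_linear products[of z x] products[of z y] scale_left_distrib)
  have B_scale: "B (k \<cdot> x) z = k * B x z" "B z (k \<cdot> x) = k * B z x" for k x z
    by (rule coeff[where j = "k * Q x z"],
        simp add: mul_linear products[of x z] scale_right_distrib,
        rule coeff[where j = "k * Q z x"],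
        simp add: mul_linear products[of z x] scale_right_distrib)
  have B_c: "B c x = 0" "B x c = 0" and B_d: "B d x = 0" "B x d = 0" for x
    using coeff[of c x 0 "r x"] coeff[of x c 0 "l x"] coeff[of d x 0 0] coeff[of x d 0 0]
      l[of x] r[of x] zero by simp_all
  have left: "(x \<star> y) \<star> z = (B x y * r z) \<cdot> d" for x y z
    by (subst products) (simp add: mul_linear r zero)
  have right: "x \<star> (y \<star> z) = (B y z * l x) \<cdot> d" for x y z
    by (subst products[of y z]) (simp add: mul_linear l zero)
  have rc: "B x y * r z = B x z * r y" for x y z
    using right_commutative[of x y z] by (simp add: left d)
  have ls: "B x y * r z - B y z * l x = B y x * r z - B x z * l y" for x y z
    using left_symmetric[of x y z] by (simp add: left right d flip: scale_left_diff_distrib)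
  have "\<exists>f g t m. Vector_Spaces.linear (\<cdot>) (*) f \<and> Vector_Spaces.linear (\<cdot>) (*) g \<and>
      (\<forall>x y. B x y = f x * g y) \<and> (\<forall>x. r x = m * g x) \<and> (\<forall>x. l x = t * f x - m * g x) \<and>
      (t \<noteq> 0 \<or> m \<noteq> 0)"
  proof (cases "\<forall>x. r x = 0")
    case False
    then obtain z where z: "r z \<noteq> 0" by blast
    define f where "f x = B x z / r z" for x
    have B: "B x y = f x * r y" for x y using rc[of x y z] z by (simp add: f_def field_simps)
    then have "f x0 \<noteq> 0" using nontrivial by auto
    define t where "t = (r x0 + l x0) / f x0"
    have "l y = t * f y - 1 * r y" for y
    proof -
      have "r z * (f x0 * (r y + l y)) = r z * (f y * (r x0 + l x0))"
        using ls[of x0 y z] by (simp add: B algebra_simps)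
      then have "f x0 * (r y + l y) = f y * (r x0 + l x0)" using z by simp
      then show ?thesis using \<open>f x0 \<noteq> 0\<close> by (simp add: t_def field_simps)
    qed
    moreover have "Vector_Spaces.linear (\<cdot>) (*) f" "Vector_Spaces.linear (\<cdot>) (*) r"
      by (auto intro!: linear simp: f_def B_add B_scale r_add r_scale add_divide_distrib)
    ultimately show ?thesis using B by (intro exI[of _ f] exI[of _ r] exI[of _ t] exI[of _ 1]) auto
  next
    case True
    then have "l x1 \<noteq> 0" using nontrivial by auto
    define g where "g y = B x1 y / l x1" for y
    have "B x y = l x * g y" for x y
      using ls[of x1 x y] True \<open>l x1 \<noteq> 0\<close> by (simp add: g_def field_simps)
    moreover have "Vector_Spaces.linear (\<cdot>) (*) g" "Vector_Spaces.linear (\<cdot>) (*) l"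
      by (auto intro!: linear simp: g_def B_add B_scale l_add l_scale add_divide_distrib)
    ultimately show ?thesis using True by (intro exI[of _ l] exI[of _ g] exI[of _ 1] exI[of _ 0]) auto
  qed
  then obtain f g t m where f: "Vector_Spaces.linear (\<cdot>) (*) f"
    and g: "Vector_Spaces.linear (\<cdot>) (*) g"
    and B: "\<And>x y. B x y = f x * g y" and r': "\<And>x. r x = m * g x"
    and l': "\<And>x. l x = t * f x - m * g x" and tm: "t \<noteq> 0 \<or> m \<noteq> 0" by blast
  interpret f: Vector_Spaces.linear "(\<cdot>)" "(*)" f by (rule f)
  interpret g: Vector_Spaces.linear "(\<cdot>)" "(*)" g by (rule g)
  have nz: "f x0 \<noteq> 0" "g y0 \<noteq> 0" using nontrivial B by auto
  have vanish: "f c = 0" "f d = 0" "g c = 0" "g d = 0"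
    using B_c[of y0] B_d[of y0] B_c[of x0] B_d[of x0] nz by (simp_all add: B)
  show ?thesis
  proof (cases "\<exists>\<kappa>. \<forall>x. g x = \<kappa> * f x")
    case True
    then obtain \<kappa> where \<kappa>: "\<And>x. g x = \<kappa> * f x" by blast
    obtain e1 e3 where e: "f e1 = 1" "f e3 = 0" "span {e1, e3, c, d} = UNIV"
      using functional_adapted_basis[OF f span vanish(1,2) nz(1)] .
    have "\<kappa> \<noteq> 0" using nz \<kappa> by auto
    define e2 where "e2 = e1 \<star> e1"
    have e2: "e2 = \<kappa> \<cdot> c + Q e1 e1 \<cdot> d"
      using products[of e1 e1] by (simp add: e2_def B e \<kappa>)
    have "span {c, d, e1, e3} = UNIV" using e(3) by (simp only: insert_commute)
    then have "span {e2, d, e1, e3} = UNIV"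
      unfolding e2 using \<open>\<kappa> \<noteq> 0\<close> by (rule span_replace) (simp add: span_base span_scale)
    then have "span {e1, e2, e3, d} = UNIV" by (simp only: insert_commute)
    then have "square_type e1 e2 e3 d (\<kappa> * (t - m * \<kappa>)) (\<kappa> * (m * \<kappa>)) (Q e1 e3) (Q e3 e1) (Q e3 e3)"
      unfolding square_type_def has_table_def
      using products[of e1 e3] products[of e3 e1] products[of e3 e3]
      by (simp add: e2_def[symmetric] B \<kappa> e zero, simp add: e2 mul_linear zero l r l' r' \<kappa> e vanish f.add f.scale)
    moreover have "\<kappa> * (t - m * \<kappa>) \<noteq> 0 \<or> \<kappa> * (m * \<kappa>) \<noteq> 0" using tm \<open>\<kappa> \<noteq> 0\<close> by auto
    ultimately show ?thesis by blast
  next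
    case False
    obtain e1 e2 where e: "f e1 = 1" "f e2 = 0" "g e1 = 0" "g e2 = 1"
      "span {e1, e2, c, d} = UNIV"
      using dual_adapted_basis[OF f g span vanish nz(1) False] .
    define e3 where "e3 = e1 \<star> e2"
    have e3: "e3 = c + Q e1 e2 \<cdot> d"
      using products[of e1 e2] by (simp add: e3_def B e)
    have "span {c, d, e1, e2} = UNIV" using e(5) by (simp only: insert_commute)
    then have "span {e3, d, e1, e2} = UNIV"
      unfolding e3 by (rule span_shift) (simp add: span_base span_scale)
    then have "span {e1, e2, e3, d} = UNIV" by (simp only: insert_commute)
    then have "mixed_type e1 e2 e3 d (Q e1 e1) (Q e2 e1) (Q e2 e2) t (- m)"
      unfolding mixed_type_def has_table_def
      using products[of e1 e1] products[of e2 e1] products[of e2 e2]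
      by (simp add: e3_def[symmetric] B e zero, simp add: e3 mul_linear zero l r l' r' e vanish f.add f.scale g.add g.scale)
    moreover have "t \<noteq> 0 \<or> - m \<noteq> 0" using tm by auto
    ultimately show ?thesis by blast
  qed
qed

lemma two_generated_case:
  assumes dim: "dim (lcs 1) = 2" and nz: "lcs 2 \<noteq> {0}"
  shows "(\<exists>e1 e2 e3 e4 \<alpha> \<beta> p q s. square_type e1 e2 e3 e4 \<alpha> \<beta> p q s \<and> (\<alpha> \<noteq> 0 \<or> \<beta> \<noteq> 0)) \<or>
    (\<exists>e1 e2 e3 e4 p q s t m. mixed_type e1 e2 e3 e4 p q s t m \<and> (t \<noteq> 0 \<or> m \<noteq> 0))"
proof -
  have suc: "Suc 0 = 1" "Suc 1 = 2" "Suc 2 = 3" by simp_all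
  \<comment> \<open>keeps the index in \<open>lcs 1\<close> from being rewritten to \<open>Suc 0\<close>\<close>
  note [simp del] = One_nat_def
  have ne1: "lcs 1 \<noteq> {0}" unfolding dim_lcs_eq_0[symmetric] dim by simp
  have "dim (lcs 2) \<noteq> 0" using nz unfolding dim_lcs_eq_0 .
  then have dim2: "dim (lcs 2) = 1" using dim_lcs_less[OF ne1] dim unfolding suc by linarith
  then have "dim (lcs 3) = 0" using dim_lcs_less[OF nz] unfolding suc by linarith
  then have lcs3: "x \<in> lcs 3 \<Longrightarrow> x = 0" for x unfolding dim_lcs_eq_0 by simp
  have dec: "lcs 2 \<subseteq> lcs 1" using lcs_decreasing[of 1] unfolding suc .
  obtain d where d: "d \<in> lcs 2" "d \<noteq> 0" "span {d} = lcs 2"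
    using obtain_span_singleton[OF subspace_lcs dim2] .
  obtain c where c: "c \<in> lcs 1" "c \<notin> lcs 2" "span (insert c (lcs 2)) = lcs 1"
    using obtain_span_insert[OF subspace_lcs subspace_lcs dec] dim dim2 by auto
  have cd: "span {c, d} = lcs 1" using c(3) d(3) span_insert_span[of c "{d}"] by simp
  have "lcs 1 \<noteq> UNIV" using dim dim4 by auto
  then obtain b where "b \<notin> lcs 1" by blast
  then have "dim (span (insert b (lcs 1))) = 3" using dim by (simp add: dim_insert)
  then obtain a where "span (insert a (span (insert b (lcs 1)))) = UNIV"
    using obtain_span_insert[OF subspace_span subspace_UNIV, of "insert b (lcs 1)"] dim4 by auto
  then have span: "span {a, b, c, d} = UNIV"
    by (simp only: cd[symmetric] span_insert_span)
  have c': "c \<notin> span {d}" using c d by simp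
  have "\<exists>k j. x \<star> y = k \<cdot> c + j \<cdot> d" for x y
  proof -
    have "x \<star> y \<in> span {c, d}" using mul_in_lcs(1)[of y 0 x, unfolded suc] cd by simp
    then obtain k where "x \<star> y - k \<cdot> c \<in> span {d}" by (auto simp: span_insert)
    then obtain j where "x \<star> y - k \<cdot> c = j \<cdot> d" by (auto simp: span_singleton)
    then have "x \<star> y = k \<cdot> c + j \<cdot> d" by (simp add: algebra_simps)
    then show ?thesis by blast
  qed
  then obtain B Q where products: "\<And>x y. x \<star> y = B x y \<cdot> c + Q x y \<cdot> d" by metis
  have "\<exists>k. x \<star> c = k \<cdot> d" "\<exists>k. c \<star> x = k \<cdot> d" for x
    using mul_in_lcs[OF c(1), of x] d(3)[symmetric] unfolding suc by (auto simp: span_singleton)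
  then obtain l r where lr: "\<And>x. x \<star> c = l x \<cdot> d" "\<And>x. c \<star> x = r x \<cdot> d" by metis
  have zero: "x \<star> d = 0" "d \<star> x = 0" "c \<star> c = 0" for x
    using mul_in_lcs[OF d(1), of x] lcs1_lcs_mul[OF c(1) c(1)] lcs3 unfolding suc by auto
  have "\<exists>x y. B x y \<noteq> 0"
  proof (rule ccontr)
    assume "\<not> ?thesis"
    then have "x \<star> y \<in> lcs 2" for x y
      using products[of x y] d(3) span_scale[OF span_base, of d "{d}"] by simp
    then have "lcs (Suc 0) \<subseteq> lcs 2" by (intro lcs_Suc_subset subspace_lcs) auto
    then show False using c unfolding suc by auto
  qed
  moreover have "\<exists>x. l x \<noteq> 0 \<or> r x \<noteq> 0"
  proof (rule ccontr)
    assume "\<not> ?thesis"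
    then have lr0: "x \<star> c = 0" "c \<star> x = 0" for x using lr by simp_all
    have "x \<star> y = 0 \<and> y \<star> x = 0" if "y \<in> lcs 1" for x y
    proof -
      from that obtain k where "y - k \<cdot> c \<in> span {d}" by (auto simp: span_insert simp flip: cd)
      then obtain j where "y - k \<cdot> c = j \<cdot> d" by (auto simp: span_singleton)
      then have "y = k \<cdot> c + j \<cdot> d" by (simp add: algebra_simps)
      then show ?thesis by (simp add: mul_linear lr0 zero)
    qed
    then have "lcs (Suc 1) \<subseteq> {0}" by (intro lcs_Suc_subset) auto
    then show False using nz zero_in_lcs[of 2] unfolding suc by blast
  qed
  ultimately obtain x0 y0 x1 where "B x0 y0 \<noteq> 0" "l x1 \<noteq> 0 \<or> r x1 \<noteq> 0" by blast
  then show ?thesis by (rule two_generators[OF span c' d(2) zero products lr])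
qed

section \<open>Structure of the one-generated algebras\<close>

text \<open>Modulo \<open>A\<^sup>2\<close> every element is a multiple of \<open>e\<^sub>1\<close>; expanding products shows that \<open>A\<^sup>2\<close> is spanned by
  \<open>e\<^sub>2 = e\<^sub>1 e\<^sub>1\<close> modulo \<open>A\<^sup>3\<close>, and \<open>A\<^sup>3\<close> by \<open>f = e\<^sub>1 e\<^sub>2\<close> and \<open>g = e\<^sub>2 e\<^sub>1\<close> modulo \<open>A\<^sup>4\<close>. When \<open>A\<^sup>4 \<noteq> 0\<close>,
  the dimensions are \<open>4, 3, 2, 1, 0\<close>, and the products falling into \<open>A\<^sup>4\<close> are related by right
  commutativity for \<open>(e\<^sub>1, e\<^sub>1, e\<^sub>2)\<close> and left symmetry for \<open>(e\<^sub>1, e\<^sub>2, e\<^sub>1)\<close>.\<close>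

lemma one_generated_case:
  assumes dim: "dim (lcs 1) = 3"
  shows "isomorphic_to N03 \<or> isomorphic_to N21 \<or> (\<exists>\<kappa>. isomorphic_to (N22 \<kappa>)) \<or>
    isomorphic_to N23 \<or> isomorphic_to N24"
proof -
  have suc: "Suc 0 = 1" "Suc 1 = 2" "Suc 2 = 3" "Suc 3 = 4" by simp_all
  \<comment> \<open>keeps the index in \<open>lcs 1\<close> from being rewritten to \<open>Suc 0\<close>\<close>
  note [simp del] = One_nat_def
  note sub = subspace_lcs
  have dec: "lcs 2 \<subseteq> lcs 1" "lcs 3 \<subseteq> lcs 2" using lcs_decreasing[of 1] lcs_decreasing[of 2] unfolding suc .
  have up: "x \<star> y \<in> lcs 1" for x y using mul_in_lcs(1)[of y 0 x, unfolded suc] by simp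
  have up1: "x \<star> y \<in> lcs 2" "y \<star> x \<in> lcs 2" if "y \<in> lcs 1" for x y
    using mul_in_lcs[OF that, unfolded suc] by simp_all
  have up2: "x \<star> y \<in> lcs 3" "y \<star> x \<in> lcs 3" if "y \<in> lcs 2" for x y
    using mul_in_lcs[OF that, unfolded suc] by simp_all
  have up3: "x \<star> y \<in> lcs 4" "y \<star> x \<in> lcs 4" if "y \<in> lcs 3" for x y
    using mul_in_lcs[OF that, unfolded suc] by simp_all
  have square: "x \<star> y \<in> lcs 3" if "x \<in> lcs 1" "y \<in> lcs 1" for x y
    using lcs1_lcs_mul[OF that, unfolded suc] .
  obtain e1 where e1: "span (insert e1 (lcs 1)) = UNIV"
    using obtain_span_insert[OF sub[of 1] sub[of 0]] dim dim4 by auto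
  have e1_decomp: "\<exists>k u. x = k \<cdot> e1 + u \<and> u \<in> lcs 1" for x
  proof -
    have "x \<in> span (insert e1 (lcs 1))" using e1 by simp
    then obtain k where "x - k \<cdot> e1 \<in> lcs 1" by (auto simp: span_insert)
    then show ?thesis by (intro exI[of _ k] exI[of _ "x - k \<cdot> e1"]) simp
  qed
  define e2 where "e2 = e1 \<star> e1"
  have e2: "e2 \<in> lcs 1" using up by (simp add: e2_def)
  have lcs1: "lcs 1 \<subseteq> span (insert e2 (lcs 2))"
  proof -
    have "x \<star> y \<in> span (insert e2 (lcs 2))" for x y
    proof -
      obtain k u where x: "x = k \<cdot> e1 + u" "u \<in> lcs 1" using e1_decomp by blast
      obtain j v where y: "y = j \<cdot> e1 + v" "v \<in> lcs 1" using e1_decomp by blast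
      have "x \<star> y = (k * j) \<cdot> e2 + (k \<cdot> (e1 \<star> v) + u \<star> y)"
        by (simp add: x(1) y(1) mul_linear scale_right_distrib e2_def)
      moreover have "k \<cdot> (e1 \<star> v) + u \<star> y \<in> lcs 2"
        using up1 x y by (intro subspace_add subspace_scale sub) auto
      ultimately show ?thesis by (simp add: span_add span_base span_scale)
    qed
    then have "lcs (Suc 0) \<subseteq> span (insert e2 (lcs 2))" by (intro lcs_Suc_subset) auto
    then show ?thesis unfolding suc .
  qed
  have e2_decomp: "\<exists>k w. y = k \<cdot> e2 + w \<and> w \<in> lcs 2" if "y \<in> lcs 1" for y
  proof -
    from that lcs1 obtain k where "y - k \<cdot> e2 \<in> lcs 2" by (auto simp: span_insert)
    then show ?thesis by (intro exI[of _ k] exI[of _ "y - k \<cdot> e2"]) simp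
  qed
  define f g where "f = e1 \<star> e2" and "g = e2 \<star> e1"
  have fg: "f \<in> lcs 2" "g \<in> lcs 2" using up1[OF e2] by (simp_all add: f_def g_def)
  have lcs2: "lcs 2 \<subseteq> S" if "subspace S" "f \<in> S" "g \<in> S" "lcs 3 \<subseteq> S" for S
  proof -
    have "x \<star> y \<in> S \<and> y \<star> x \<in> S" if "y \<in> lcs 1" for x y
    proof -
      obtain k u where x: "x = k \<cdot> e1 + u" "u \<in> lcs 1" using e1_decomp by blast
      from e2_decomp[OF that] obtain j w where y: "y = j \<cdot> e2 + w" "w \<in> lcs 2" by blast
      have "x \<star> y = (k * j) \<cdot> f + (j \<cdot> (u \<star> e2) + x \<star> w)"
        "y \<star> x = (k * j) \<cdot> g + (j \<cdot> (e2 \<star> u) + w \<star> x)"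
        by (simp_all add: x(1) y(1) mul_linear scale_right_distrib f_def g_def ac_simps)
      moreover have "u \<star> e2 \<in> S" "e2 \<star> u \<in> S" "x \<star> w \<in> S" "w \<star> x \<in> S"
        using \<open>lcs 3 \<subseteq> S\<close> square[OF x(2) e2] square[OF e2 x(2)] up2[OF y(2)] by auto
      ultimately show ?thesis
        using \<open>subspace S\<close> \<open>f \<in> S\<close> \<open>g \<in> S\<close> by (simp add: subspace_add subspace_scale)
    qed
    then have "lcs (Suc 1) \<subseteq> S" by (intro lcs_Suc_subset \<open>subspace S\<close>) auto
    then show ?thesis unfolding suc .
  qed
  show ?thesis
  proof (cases "lcs 3 = {0}")
    case True
    have "lcs 2 \<subseteq> span {e1, e2, g, f}"
      by (rule lcs2) (auto simp: True span_base span_zero)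
    moreover have "span (insert e2 (lcs 2)) \<subseteq> span {e1, e2, g, f}"
      using calculation by (intro span_minimal) (auto simp: span_base)
    ultimately have "span (insert e1 (lcs 1)) \<subseteq> span {e1, e2, g, f}"
      using lcs1 by (intro span_minimal) (auto simp: span_base)
    then have "span {e1, e2, g, f} = UNIV" using e1 by auto
    moreover have "x \<star> y = 0" "y \<star> x = 0" if "y \<in> lcs 2" for x y
      using up2[OF that] True by simp_all
    moreover have "e2 \<star> e2 = 0" using square[OF e2 e2] True by simp
    ultimately have "has_table [e1, e2, g, f]
        [[e2, f, 0, 0], [g, 0, 0, 0], [0, 0, 0, 0], [0, 0, 0, 0]]"
      using fg by (simp add: has_table_def e2_def[symmetric] f_def[symmetric] g_def[symmetric])
    then show ?thesis using isomorphic_N03 by blast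
  next
    case False
    have ne2: "lcs 2 \<noteq> {0}" using False dec(2) zero_in_lcs[of 3] by (metis subset_singletonD empty_iff)
    have ne1: "lcs 1 \<noteq> {0}" unfolding dim_lcs_eq_0[symmetric] dim by simp
    have "dim (lcs 3) \<noteq> 0" using False unfolding dim_lcs_eq_0 .
    then have dims: "dim (lcs 3) = 1" "dim (lcs 2) = 2" "dim (lcs 4) = 0"
      using dim_lcs_less[OF ne1] dim_lcs_less[OF ne2] dim_lcs_less[OF False] dim
      unfolding suc by linarith+
    have zero4: "x \<in> lcs 4 \<Longrightarrow> x = 0" for x using dims(3) unfolding dim_lcs_eq_0 by simp
    obtain d where d: "d \<in> lcs 3" "d \<noteq> 0" "span {d} = lcs 3"
      using obtain_span_singleton[OF sub dims(1)] .
    have zero3: "x \<star> y = 0" "y \<star> x = 0" if "y \<in> lcs 3" for x y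
      using up3[OF that] zero4 by auto
    have zero12: "x \<star> y = 0" "y \<star> x = 0" if "x \<in> lcs 1" "y \<in> lcs 2" for x y
      using lcs1_lcs_mul[OF that, unfolded suc] lcs2_lcs1_mul[OF that(2,1)] zero4 by simp_all
    have multiple: "\<exists>k. x = k \<cdot> d" if "x \<in> lcs 3" for x
      using that d(3)[symmetric] by (auto simp: span_singleton)
    have spans: "span (insert e3 (lcs 3)) = lcs 2" "span {e1, e2, e3, d} = UNIV"
      if "e3 \<in> lcs 2" "e3 \<notin> lcs 3" for e3
    proof -
      show e3: "span (insert e3 (lcs 3)) = lcs 2"
        using that dims dec sub by (intro span_insert_eq_of_dim) auto
      have lcs3: "lcs 3 \<subseteq> span {e1, e2, e3, d}"
        unfolding d(3)[symmetric] by (rule span_mono) auto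
      have "lcs 2 \<subseteq> span {e1, e2, e3, d}"
        unfolding e3[symmetric] using lcs3 by (intro span_minimal) (auto simp: span_base)
      then have "lcs 1 \<subseteq> span {e1, e2, e3, d}"
        using lcs1 span_minimal[of "insert e2 (lcs 2)" "span {e1, e2, e3, d}"]
        by (auto simp: span_base)
      then have "span (insert e1 (lcs 1)) \<subseteq> span {e1, e2, e3, d}"
        by (intro span_minimal) (auto simp: span_base)
      then show "span {e1, e2, e3, d} = UNIV" using e1 by auto
    qed
    have nonzero: "e1 \<star> e3 \<noteq> 0 \<or> e3 \<star> e1 \<noteq> 0" if e3: "e3 \<in> lcs 2" "e3 \<notin> lcs 3" for e3
    proof (rule ccontr)
      assume "\<not> ?thesis"
      then have zero: "e1 \<star> e3 = 0" "e3 \<star> e1 = 0" by simp_all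
      have "x \<star> y = 0 \<and> y \<star> x = 0" if "y \<in> lcs 2" for x y
      proof -
        obtain k u where x: "x = k \<cdot> e1 + u" "u \<in> lcs 1" using e1_decomp by blast
        from that spans(1)[OF e3, symmetric] obtain j where j: "y - j \<cdot> e3 \<in> lcs 3"
          by (auto simp: span_insert)
        then obtain w where y: "y = j \<cdot> e3 + w" "w \<in> lcs 3" by (metis add.commute diff_add_cancel)
        show ?thesis
          by (simp add: x(1) y(1) mul_linear zero zero3[OF y(2)] zero12[OF x(2) e3(1)])
      qed
      then have "lcs (Suc 2) \<subseteq> {0}" by (intro lcs_Suc_subset) auto
      then show False using False zero_in_lcs[of 3] unfolding suc by blast
    qed
    have e2e2: "e2 \<star> e2 = f \<star> e1"
      using right_commutative[of e1 e1 e2] by (simp add: e2_def f_def)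
    have assoc: "f \<star> e1 - e1 \<star> g = g \<star> e1 - e2 \<star> e2"
      using left_symmetric[of e1 e2 e1] by (simp add: e2_def f_def g_def)
    show ?thesis
    proof (cases "f \<in> lcs 3")
      case f3: False
      obtain \<kappa> where "g - \<kappa> \<cdot> f \<in> lcs 3"
        using fg(2) spans(1)[OF fg(1) f3, symmetric] by (auto simp: span_insert)
      then obtain \<nu> where "g - \<kappa> \<cdot> f = \<nu> \<cdot> d" using multiple by blast
      then have g: "g = \<kappa> \<cdot> f + \<nu> \<cdot> d" by (simp add: algebra_simps)
      obtain \<delta> \<epsilon> where \<delta>: "e1 \<star> f = \<delta> \<cdot> d" and \<epsilon>: "f \<star> e1 = \<epsilon> \<cdot> d"
        using multiple up2[OF fg(1)] by metis
      have "\<epsilon> \<cdot> d - (\<kappa> * \<delta>) \<cdot> d = (\<kappa> * \<epsilon>) \<cdot> d - \<epsilon> \<cdot> d"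
        using assoc e2e2 zero3[OF d(1)] by (simp add: g mul_linear \<delta> \<epsilon>)
      then have rel: "\<epsilon> - \<kappa> * \<delta> = \<kappa> * \<epsilon> - \<epsilon>"
        using d(2) by (simp flip: scale_left_diff_distrib)
      \<comment> \<open>the relation \<open>2 \<epsilon> = \<kappa> (\<delta> + \<epsilon>)\<close> makes \<open>(\<delta>, \<epsilon>)\<close> equal to \<open>h (2 - \<kappa>, \<kappa>)\<close>\<close>
      define h where "h = (\<delta> + \<epsilon>) / 2"
      have h: "\<epsilon> = \<kappa> * h" "\<delta> = (2 - \<kappa>) * h"
        using rel by (simp_all add: h_def field_simps)
      have "h \<noteq> 0" using nonzero[OF fg(1) f3] by (auto simp: \<delta> \<epsilon> h)
      define e4 where "e4 = h \<cdot> d"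
      have d': "d = (1 / h) \<cdot> e4" using \<open>h \<noteq> 0\<close> by (simp add: e4_def)
      have e4: "e4 \<in> lcs 3" using d(1) sub by (simp add: e4_def subspace_scale)
      have "span {d, e1, e2, f} = UNIV" using spans(2)[OF fg(1) f3] by (simp only: insert_commute)
      from span_replace[OF this \<open>h \<noteq> 0\<close> span_zero]
      have "span {e1, e2, f, e4} = UNIV" by (simp add: e4_def insert_commute)
      then have "cyclic_type e1 e2 f e4 \<kappa> (\<nu> / h)"
        using zero3[OF e4] zero12[OF e2 fg(1)] zero12[OF subsetD[OF dec(1) fg(1)] fg(1)] \<open>h \<noteq> 0\<close>
        by (simp add: cyclic_type_def has_table_def e2_def[symmetric] f_def[symmetric]
            g_def[symmetric] g \<delta> \<epsilon> e2e2 h) (simp add: e4_def)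
      then show ?thesis using cyclic_type_classification by blast
    next
      case f3: True
      have g3: "g \<notin> lcs 3"
      proof
        assume "g \<in> lcs 3"
        then have "lcs 2 \<subseteq> lcs 3" using lcs2[OF sub f3] by blast
        then have "lcs 3 = lcs 2" using dec by blast
        then show False using dims by simp
      qed
      obtain \<mu> where \<mu>: "f = \<mu> \<cdot> d" using multiple f3 by blast
      obtain \<delta> where \<delta>: "e1 \<star> g = \<delta> \<cdot> d" using multiple up2(1)[OF fg(2)] by blast
      have fe1: "f \<star> e1 = 0" using zero3[OF f3] by simp
      then have ge1: "g \<star> e1 = (- \<delta>) \<cdot> d" using assoc e2e2 by (simp add: \<delta>)
      have "\<delta> \<noteq> 0" using nonzero[OF fg(2) g3] by (auto simp: \<delta> ge1)
      define e4 where "e4 = \<delta> \<cdot> d"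
      have e4: "e4 \<in> lcs 3" using d(1) sub by (simp add: e4_def subspace_scale)
      have "span {d, e1, e2, g} = UNIV" using spans(2)[OF fg(2) g3] by (simp only: insert_commute)
      from span_replace[OF this \<open>\<delta> \<noteq> 0\<close> span_zero]
      have "span {e1, e2, g, e4} = UNIV" by (simp add: e4_def insert_commute)
      then have "has_table [e1, e2, g, e4]
         [[e2,           (\<mu> / \<delta>) \<cdot> e4, e4, 0],
          [g,            0,         0,  0],
          [(- 1) \<cdot> e4, 0,         0,  0],
          [0,            0,         0,  0]]"
        using zero3[OF e4] zero12[OF e2 fg(2)] zero12[OF subsetD[OF dec(1) fg(2)] fg(2)] \<open>\<delta> \<noteq> 0\<close>
        by (simp add: has_table_def e2_def[symmetric] f_def[symmetric]
            g_def[symmetric] \<mu> \<delta> ge1 e2e2 fe1) (simp add: e4_def fe1[unfolded \<mu>])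
      then show ?thesis using isomorphic_N21 by blast
    qed
  qed
qed

end

section \<open>The classification\<close>

theorem theorem6:
  fixes scale :: "complex \<Rightarrow> 'a::ab_group_add \<Rightarrow> 'a"
    and mul :: "'a \<Rightarrow> 'a \<Rightarrow> 'a"
  assumes novikov: "novikov_algebra scale mul"
    and nonzero: "\<exists>x::'a. x \<noteq> 0"
    and dim: "vector_space.dim scale (UNIV :: 'a set) = 4"
    and nilpotent: "nilpotent_algebra mul"
    and pure: "pure_algebra mul"
  shows "isomorphic_algebras scale mul (*s) N01 \<or>
         (\<exists>\<alpha>. isomorphic_algebras scale mul (*s) (N02 \<alpha>)) \<or>
         isomorphic_algebras scale mul (*s) N03 \<or>
         (\<exists>\<alpha>. isomorphic_algebras scale mul (*s) (N04 \<alpha>)) \<or>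
         isomorphic_algebras scale mul (*s) N05 \<or>
         (\<exists>\<alpha>. \<alpha> \<noteq> 0 \<and> isomorphic_algebras scale mul (*s) (N06 \<alpha>)) \<or>
         isomorphic_algebras scale mul (*s) N07 \<or>
         isomorphic_algebras scale mul (*s) N08 \<or>
         isomorphic_algebras scale mul (*s) N09 \<or>
         isomorphic_algebras scale mul (*s) N10 \<or>
         isomorphic_algebras scale mul (*s) N11 \<or>
         isomorphic_algebras scale mul (*s) N12 \<or>
         isomorphic_algebras scale mul (*s) N13 \<or>
         isomorphic_algebras scale mul (*s) N14 \<or>
         isomorphic_algebras scale mul (*s) N15 \<or>
         isomorphic_algebras scale mul (*s) N16 \<or>
         isomorphic_algebras scale mul (*s) N17 \<or>
         isomorphic_algebras scale mul (*s) N18 \<or>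
         isomorphic_algebras scale mul (*s) N19 \<or>
         (\<exists>\<alpha>. isomorphic_algebras scale mul (*s) (N20 \<alpha>)) \<or>
         isomorphic_algebras scale mul (*s) N21 \<or>
         (\<exists>\<alpha>. isomorphic_algebras scale mul (*s) (N22 \<alpha>)) \<or>
         isomorphic_algebras scale mul (*s) N23 \<or>
         isomorphic_algebras scale mul (*s) N24"
proof -
  interpret novikov_algebra scale mul by (rule novikov)
  obtain Basis where "independent Basis" "UNIV \<subseteq> span Basis" "card Basis = 4"
    using basis_exists[of UNIV] dim by metis
  then interpret nilpotent_novikov4 scale mul Basis
    by unfold_locales (auto simp: dim nilpotent intro: card_ge_0_finite)
  have lcs0: "lcs 0 \<noteq> {0}" using nonzero by auto
  have lcs2: "lcs 2 \<noteq> {0}" using lcs_2_nonzero[OF pure] .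
  then have lcs1: "lcs 1 \<noteq> {0}" using lcs_decreasing[of 1] zero_in_lcs[of 2] by (auto simp: numeral_2_eq_2)
  have "dim (lcs 2) \<noteq> 0" using lcs2 unfolding dim_lcs_eq_0 .
  then consider "dim (lcs 1) = 2" | "dim (lcs 1) = 3"
    using dim_lcs_less[OF lcs0] dim_lcs_less[OF lcs1] dim
    unfolding lcs.simps(1) One_nat_def[symmetric] Suc_1 by linarith
  then show ?thesis
  proof cases
    case 1
    from two_generated_case[OF this lcs2] consider
      e1 e2 e3 e4 \<alpha> \<beta> p q s where "square_type e1 e2 e3 e4 \<alpha> \<beta> p q s" "\<alpha> \<noteq> 0 \<or> \<beta> \<noteq> 0" |
      e1 e2 e3 e4 p q s t m where "mixed_type e1 e2 e3 e4 p q s t m" "t \<noteq> 0 \<or> m \<noteq> 0"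
      by blast
    then show ?thesis
    proof cases
      case 1
      from square_type_classification[OF this] show ?thesis by blast
    next
      case 2
      from mixed_type_classification[OF this] show ?thesis by blast
    qed
  next
    case 2
    from one_generated_case[OF this] show ?thesis by blast
  qed
qed

end
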